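(* Let $G=K_{p_1,p_2,\dots,p_k}$ with $k\ge 2$ and $p_1\ge p_2\ge\dots\ge p_k\ge 1$, let $n=p_1+\dots+p_k$, and let $q$ be an integer with $\max\{2,n-3\}\le q\le n-1$. Set $p_i=0$ for $i>k$. If $(G,q)\in\{(K_{3,3},4),(K_{4,3},4)\}$ then $ar(G,\mathcal{T}_q)=4$, and if $(G,q)=(K_{3,3,3},6)$ then $ar(G,\mathcal{T}_q)=10$. Otherwise, $$ar(G,\mathcal{T}_q)=1+\sum_{1\le i<j\le k}p_ip_j-|E_G(S_0)|$$ for any $S_0\in\mathcal{P}^*_{n-q+1}(G)$, where $|E_G(S_0)|$ is given as follows. For $q=n-1$: $|E_G(S_0)|=2n-2p_1$ if $p_1>p_2$; $=2n-p_1-p_2-1$ if $p_1=p_2$. For $q=n-2$: $|E_G(S_0)|=3n-3p_1$ if $p_1\ge p_2+2$; $=3n-2p_1-p_2-2$ if $p_2+1\ge p_1\ge p_3+1$; $=3n-p_1-p_2-p_3-3$ if $p_1=p_2=p_3$. For $q=n-3$: $|E_G(S_0)|=4n-4p_1$ if $p_1\ge p_2+3$; $=4n-3p_1-p_2-3$ if $p_1=p_2+2$ or $p_1=p_2+1\ge p_3+2$; $=4n-2p_1-2p_2-4$ if $p_1=p_2\ge p_3+1$; $=4n-2p_1-p_2-p_3-5$ if $p_4+1\le p_1\le p_2+1=p_3+1$; $=4n-\sum_{i=1}^4p_i-6$ if $p_1=p_2=p_3=p_4$.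
   Context: $K_{p_1,\dots,p_k}$ is the complete $k$-partite graph with partite sets of sizes $p_1,\dots,p_k$. A $t$-edge-coloring of $G$ is a surjective map $E(G)\to\{1,\dots,t\}$; a subgraph is rainbow if its edges have pairwise distinct colors. $ar(G,\mathcal{C})$ is the maximum $t$ such that some $t$-edge-coloring of $G$ has no rainbow subgraph isomorphic to a member of $\mathcal{C}$ ($0$ if none). $\mathcal{T}_q$ is the set of trees with exactly $q$ edges. For $S\subseteq V(G)$, $E_G(S)$ is the set of edges incident with at least one vertex of $S$. $\mathcal{P}^*_r(G)$ is the family of all sets $S$ that can be output by the following greedy procedure (over all tie-breaking choices): start with $S=\emptyset$ and $G_1=G$; for $i=1,\dots,r$, choose a vertex $u$ of minimum degree in $G_i$, add $u$ to $S$, and set $G_{i+1}=G_i-u$. *)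

theory Defs
  imports Main
begin

section \<open>Finite simple graphs\<close>

datatype 'a graph = Graph (verts: "'a set") (edges: "'a set set")

definition simple_graph :: "'a graph \<Rightarrow> bool" where
  "simple_graph G \<longleftrightarrow> finite (verts G) \<and> (\<forall>e\<in>edges G. e \<subseteq> verts G \<and> card e = 2)"

definition subgraph :: "'a graph \<Rightarrow> 'a graph \<Rightarrow> bool" where
  "subgraph H G \<longleftrightarrow> simple_graph H \<and> verts H \<subseteq> verts G \<and> edges H \<subseteq> edges G"

definition isomorphic :: "'a graph \<Rightarrow> 'b graph \<Rightarrow> bool" where
  "isomorphic G H \<longleftrightarrow>
     (\<exists>f. bij_betw f (verts G) (verts H) \<and> edges H = (\<lambda>e. f ` e) ` edges G)"

definition degree :: "'a graph \<Rightarrow> 'a \<Rightarrow> nat" where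
  "degree G u = card {e \<in> edges G. u \<in> e}"

definition delete_vertex :: "'a graph \<Rightarrow> 'a \<Rightarrow> 'a graph" where
  "delete_vertex G u = Graph (verts G - {u}) {e \<in> edges G. u \<notin> e}"

definition incident_edges :: "'a graph \<Rightarrow> 'a set \<Rightarrow> 'a set set" where
  "incident_edges G S = {e \<in> edges G. e \<inter> S \<noteq> {}}"

definition connected :: "'a graph \<Rightarrow> bool" where
  "connected G \<longleftrightarrow> verts G \<noteq> {} \<and>
     (\<forall>u\<in>verts G. \<forall>v\<in>verts G. (u, v) \<in> {(x, y). {x, y} \<in> edges G}\<^sup>*)"

definition cycle :: "'a graph \<Rightarrow> 'a list \<Rightarrow> bool" where
  "cycle G xs \<longleftrightarrow> 3 \<le> length xs \<and> distinct xs \<and> set xs \<subseteq> verts G \<and>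
     (\<forall>i<length xs. {xs ! i, xs ! (Suc i mod length xs)} \<in> edges G)"

definition tree :: "'a graph \<Rightarrow> bool" where
  "tree G \<longleftrightarrow> simple_graph G \<and> connected G \<and> (\<nexists>xs. cycle G xs)"

text \<open>Graphs on natural numbers represent every isomorphism type of finite graphs, and the
  family below is only used up to isomorphism.\<close>

definition trees_with_edges :: "nat \<Rightarrow> nat graph set" where
  "trees_with_edges q = {T. tree T \<and> card (edges T) = q}"

definition complete_multipartite :: "nat list \<Rightarrow> (nat \<times> nat) graph" where
  "complete_multipartite ps =
     (let V = {(i, a). i < length ps \<and> a < ps ! i}
      in Graph V {{u, v} | u v. u \<in> V \<and> v \<in> V \<and> fst u \<noteq> fst v})"


section \<open>Anti-Ramsey numbers\<close>

definition edge_coloring :: "'a graph \<Rightarrow> nat \<Rightarrow> ('a set \<Rightarrow> nat) \<Rightarrow> bool" where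
  "edge_coloring G t c \<longleftrightarrow> c ` edges G = {1..t}"

definition rainbow :: "('a set \<Rightarrow> nat) \<Rightarrow> 'a graph \<Rightarrow> bool" where
  "rainbow c H \<longleftrightarrow> inj_on c (edges H)"

definition rainbow_free :: "'a graph \<Rightarrow> 'b graph set \<Rightarrow> ('a set \<Rightarrow> nat) \<Rightarrow> bool" where
  "rainbow_free G \<C> c \<longleftrightarrow>
     \<not> (\<exists>H F. subgraph H G \<and> F \<in> \<C> \<and> isomorphic H F \<and> rainbow c H)"

definition ar :: "'a graph \<Rightarrow> 'b graph set \<Rightarrow> nat" where
  "ar G \<C> =
     (let T = {t. \<exists>c. edge_coloring G t c \<and> rainbow_free G \<C> c}
      in if T = {} then 0 else Max T)"


section \<open>Greedy removal of vertices of minimum degree\<close>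

text \<open>The recursion peels off the vertex chosen first, and continues in the graph without it.\<close>

fun greedy_sets :: "nat \<Rightarrow> 'a graph \<Rightarrow> 'a set set" where
  "greedy_sets 0 G = {{}}"
| "greedy_sets (Suc r) G =
     {insert u S | u S. u \<in> verts G \<and> (\<forall>v\<in>verts G. degree G u \<le> degree G v) \<and>
                        S \<in> greedy_sets r (delete_vertex G u)}"

lemma greedy_sets_nonempty:
  assumes "finite (verts G)" "r \<le> card (verts G)"
  shows "greedy_sets r G \<noteq> {}"
  using assms
proof (induction r arbitrary: G)
  case (Suc r)
  then have "verts G \<noteq> {}"
    by auto
  with Suc.prems(1) obtain u where u: "u \<in> verts G" "\<forall>v\<in>verts G. degree G u \<le> degree G v"
    using ex_min_if_finite[of "degree G ` verts G"] by (force simp: not_less)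
  have "greedy_sets r (delete_vertex G u) \<noteq> {}"
    using Suc.prems u(1) by (intro Suc.IH) (auto simp: delete_vertex_def)
  with u show ?case
    by auto
qed simp

end

theory Submission
  imports Defs
begin

text \<open>
  Upper bound: among all rainbow subgraphs \<open>R\<close> containing every colour, take one with a largest
  component \<open>W\<close>. Exchanging edges of equal colour shows that every edge leaving \<open>W\<close> has the colour
  of a bridge of \<open>W\<close>, and for a suitable bridge \<open>e\<close> any two components of \<open>R - e\<close> together have at most
  \<open>q\<close> vertices. The size of such a separated subgraph is estimated componentwise: the largest
  number of edges on \<open>j\<close> vertices of a complete multipartite graph is attained by greedy removal,
  and is convex in \<open>j\<close>. As at most three vertices are left over, convexity leaves only
  configurations with three nontrivial components, and among these only the perfect or nearly
  perfect matching of \<open>K\<^bsub>3,3\<^esub>\<close> and \<open>K\<^bsub>4,3\<^esub>\<close> and the three disjoint triangles of \<open>K\<^bsub>3,3,3\<^esub>\<close>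
  beat the greedy set.

  Lower bound: give distinct colours to the edges of a separated subgraph and one further colour
  to all other edges; a rainbow tree then meets at most two components.
\<close>

text \<open>The obstacle in the upper bound is the choice of the bridge. Exchanging an edge bounds a
  component outside \<open>W\<close> only by the side of the bridge away from the vertex where the
  new edge starts, while a bound by both sides is needed. A complete multipartite graph gives the
  missing freedom: a component with at least two vertices contains an edge, so it has a neighbour of
  every vertex, and the exchange may start anywhere in \<open>W\<close>. The deleted bridge is the
  summand 1 of the formula. In the counting, two components of sizes \<open>a\<close> and
  \<open>c\<close> with \<open>a + c \<le> q\<close> are compared with a single one on
  \<open>q - 1\<close> vertices: all but one vertex of the smaller component move into the larger
  one. The vertices outside these two exceed the slack \<open>q - a - c\<close> by
  \<open>n - q \<le> 3\<close>. Each further component may leave one vertex behind, so extra work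
  arises only if there are fewer than \<open>n - q\<close> of them.\<close>

section \<open>Linked vertex sets and trees\<close>

text \<open>Connectivity is expressed by cuts rather than by paths, which suits edge exchanges; unlike
  \<^const>\<open>connected\<close>, it allows edges of \<open>R\<close> that leave \<open>X\<close>.\<close>

definition linked :: "'a set set \<Rightarrow> 'a set \<Rightarrow> bool" where
  "linked R X \<longleftrightarrow> X \<noteq> {} \<and>
     (\<forall>Y. Y \<subseteq> X \<and> Y \<noteq> {} \<and> Y \<noteq> X \<longrightarrow> (\<exists>u\<in>Y. \<exists>v\<in>X - Y. {u, v} \<in> R))"

lemma linkedI:
  assumes "X \<noteq> {}"
    and "\<And>Y. Y \<subseteq> X \<Longrightarrow> Y \<noteq> {} \<Longrightarrow> Y \<noteq> X \<Longrightarrow> \<exists>u\<in>Y. \<exists>v\<in>X - Y. {u, v} \<in> R"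
  shows "linked R X"
  using assms unfolding linked_def by blast

lemma linkedD:
  assumes "linked R X" "Y \<subseteq> X" "Y \<noteq> {}" "Y \<noteq> X"
  obtains u v where "u \<in> Y" "v \<in> X - Y" "{u, v} \<in> R"
  using assms unfolding linked_def by blast

lemma linked_nonempty: "linked R X \<Longrightarrow> X \<noteq> {}"
  by (simp add: linked_def)

lemma linked_singleton: "linked R {x}"
  unfolding linked_def by blast

lemma linked_cong_subset:
  assumes "linked R X" "\<And>u v. u \<in> X \<Longrightarrow> v \<in> X \<Longrightarrow> {u, v} \<in> R \<Longrightarrow> {u, v} \<in> R'"
  shows "linked R' X"
proof (rule linkedI)
  show "X \<noteq> {}" using linked_nonempty[OF assms(1)] .
next
  fix Y assume Y: "Y \<subseteq> X" "Y \<noteq> {}" "Y \<noteq> X"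
  obtain u v where "u \<in> Y" "v \<in> X - Y" "{u, v} \<in> R"
    using linkedD[OF assms(1) Y] .
  then show "\<exists>u\<in>Y. \<exists>v\<in>X - Y. {u, v} \<in> R'"
    using assms(2)[of u v] Y(1) by blast
qed

lemma linked_mono: "linked R X \<Longrightarrow> R \<subseteq> R' \<Longrightarrow> linked R' X"
  by (erule linked_cong_subset) auto

text \<open>A cut of the union either cuts one of the two parts properly, where linkedness of that
  part applies, or separates \<open>A\<close> from \<open>B\<close>, where \<open>{a, b}\<close>
  crosses it.\<close>

lemma linked_Un_edge:
  assumes "linked R A" "linked R B" "a \<in> A" "b \<in> B" "{a, b} \<in> R"
  shows "linked R (A \<union> B)"
proof (rule linkedI)
  show "A \<union> B \<noteq> {}"
    using assms by auto
next
  fix Y assume Y: "Y \<subseteq> A \<union> B" "Y \<noteq> {}" "Y \<noteq> A \<union> B"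
  show "\<exists>u\<in>Y. \<exists>v\<in>A \<union> B - Y. {u, v} \<in> R"
  proof (cases "(Y \<inter> A = {} \<or> A \<subseteq> Y) \<and> (Y \<inter> B = {} \<or> B \<subseteq> Y)")
    case True
    then have "(A \<subseteq> Y \<and> Y \<inter> B = {}) \<or> (B \<subseteq> Y \<and> Y \<inter> A = {})"
      using Y by auto
    then show ?thesis
      using assms(3-5) by (metis DiffI UnCI disjoint_iff insert_commute subsetD)
  next
    case False
    then consider "Y \<inter> A \<noteq> {}" "Y \<inter> A \<noteq> A" | "Y \<inter> B \<noteq> {}" "Y \<inter> B \<noteq> B"
      by blast
    then show ?thesis
    proof cases
      case 1
      then obtain u v where "u \<in> Y \<inter> A" "v \<in> A - Y \<inter> A" "{u, v} \<in> R"
        using linkedD[OF assms(1), of "Y \<inter> A"] by auto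
      then show ?thesis by auto
    next
      case 2
      then obtain u v where "u \<in> Y \<inter> B" "v \<in> B - Y \<inter> B" "{u, v} \<in> R"
        using linkedD[OF assms(2), of "Y \<inter> B"] by auto
      then show ?thesis by auto
    qed
  qed
qed

lemma linked_insert_edge:
  assumes "linked R A" "a \<in> A" "{a, b} \<in> R"
  shows "linked R (insert b A)"
  using linked_Un_edge[OF assms(1) linked_singleton[of R b] assms(2) _ assms(3)] by simp

text \<open>A bridge \<open>e\<close> of \<open>W\<close> with its two sides. The sides are recorded
  as linked without \<open>e\<close> because they survive the exchange of \<open>e\<close> for
  another edge.\<close>

definition splits :: "'a set set \<Rightarrow> 'a set \<Rightarrow> 'a set \<Rightarrow> 'a set \<Rightarrow> 'a set \<Rightarrow> bool" where
  "splits R W e A B \<longleftrightarrow> e \<in> R \<and> W = A \<union> B \<and> A \<inter> B = {} \<and>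
     linked (R - {e}) A \<and> linked (R - {e}) B \<and> (\<exists>a\<in>A. \<exists>b\<in>B. e = {a, b}) \<and>
     (\<forall>a\<in>A. \<forall>b\<in>B. {a, b} \<in> R \<longrightarrow> {a, b} = e)"

lemma splits_sym: "splits R W e A B \<Longrightarrow> splits R W e B A"
  unfolding splits_def by (metis Int_commute Un_commute insert_commute)

text \<open>Of the two parts of a cut of \<open>A\<close>, one avoids the endpoint \<open>a\<close>.
  As a cut of \<open>X\<close> it is crossed by an edge other than \<open>e\<close>, the only edge
  leaving \<open>A\<close>, so this edge stays inside \<open>A\<close>.\<close>

lemma linked_side:
  assumes "linked R X" "A \<subseteq> X" "A \<noteq> {}"
    and e: "a \<in> A" "b \<in> X - A" "e = {a, b}"
    and only: "\<And>x y. x \<in> A \<Longrightarrow> y \<in> X - A \<Longrightarrow> {x, y} \<in> R \<Longrightarrow> {x, y} = e"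
  shows "linked (R - {e}) A"
proof (rule linkedI)
  fix Y assume Y: "Y \<subseteq> A" "Y \<noteq> {}" "Y \<noteq> A"
  define Z where "Z = (if a \<in> Y then A - Y else Y)"
  have Z: "Z \<subseteq> X" "Z \<noteq> {}" "Z \<noteq> X" "a \<notin> Z" "Z \<subseteq> A"
    using Y assms(2) e by (auto simp: Z_def)
  then obtain u v where uv: "u \<in> Z" "v \<in> X - Z" "{u, v} \<in> R"
    using linkedD[OF assms(1)] by metis
  have "v \<in> A"
  proof (rule ccontr)
    assume "v \<notin> A"
    then have "{u, v} = {a, b}"
      using uv Z only[of u v] e by auto
    then show False
      using \<open>v \<notin> A\<close> uv Z e by (auto simp: doubleton_eq_iff)
  qed
  moreover have "{u, v} \<noteq> e"
    using \<open>v \<in> A\<close> uv Z e by (auto simp: doubleton_eq_iff)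
  ultimately show "\<exists>u\<in>Y. \<exists>v\<in>A - Y. {u, v} \<in> R - {e}"
    using uv Z by (cases "a \<in> Y") (auto simp: Z_def insert_commute)
qed (use assms in auto)

lemma bridge_splits:
  assumes "linked R W" "\<not> linked (R - {e}) W"
  obtains A B where "splits R W e A B"
proof -
  obtain Y where Y: "Y \<subseteq> W" "Y \<noteq> {}" "Y \<noteq> W"
    and no: "\<And>u v. u \<in> Y \<Longrightarrow> v \<in> W - Y \<Longrightarrow> {u, v} \<notin> R - {e}"
    using assms(2) linked_nonempty[OF assms(1)] linkedI[of W "R - {e}"] by metis
  then obtain a b where ab: "a \<in> Y" "b \<in> W - Y" "{a, b} \<in> R"
    using linkedD[OF assms(1)] by metis
  then have e: "e = {a, b}"
    using no by blast
  have 1: "linked (R - {e}) Y"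
    by (rule linked_side[OF assms(1) Y(1,2) ab(1,2) e]) (use no in blast)
  have 2: "linked (R - {e}) (W - Y)"
  proof (rule linked_side[OF assms(1), of _ b a])
    show "{x, y} = e" if "x \<in> W - Y" "y \<in> W - (W - Y)" "{x, y} \<in> R" for x y
      using no[of y x] that by (auto simp: insert_commute)
  qed (use Y ab e in auto)
  have "splits R W e Y (W - Y)"
    unfolding splits_def using 1 2 Y ab e no by (intro conjI) blast+
  then show thesis by (rule that)
qed

lemma linked_in_side:
  assumes "splits R W e A B" "linked (R - {e}) X" "X \<subseteq> W"
  shows "X \<subseteq> A \<or> X \<subseteq> B"
proof (rule ccontr)
  assume "\<not> ?thesis"
  moreover have "W = A \<union> B"
    using assms(1) by (simp add: splits_def)
  ultimately have "X \<inter> A \<noteq> {}" "X \<inter> A \<noteq> X"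
    using assms(3) by blast+
  then obtain u v where uv: "u \<in> X \<inter> A" "v \<in> X - X \<inter> A" "{u, v} \<in> R - {e}"
    using linkedD[OF assms(2), of "X \<inter> A"] by blast
  then have "v \<in> B"
    using assms(1,3) unfolding splits_def by auto
  then show False
    using uv assms(1) unfolding splits_def by blast
qed

section \<open>Trees inside linked sets, and the number of edges of acyclic graphs\<close>

lemma tree_singleton: "tree (Graph {x} {})"
  unfolding tree_def simple_graph_def connected_def cycle_def by fastforce

text \<open>Serves to exclude a vertex with a single neighbour from every cycle.\<close>

lemma cycle_neighbours:
  assumes "cycle G xs" "v \<in> set xs"
  obtains x y where "x \<in> set xs" "y \<in> set xs" "x \<noteq> y" "x \<noteq> v" "y \<noteq> v"
    "{v, x} \<in> edges G" "{v, y} \<in> edges G"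
proof -
  let ?l = "length xs"
  have l: "3 \<le> ?l" and d: "distinct xs"
    and E: "\<And>i. i < ?l \<Longrightarrow> {xs ! i, xs ! (Suc i mod ?l)} \<in> edges G"
    using assms unfolding cycle_def by auto
  obtain i where i: "i < ?l" "v = xs ! i"
    using assms(2) by (metis in_set_conv_nth)
  define j where "j = Suc i mod ?l"
  \<comment> \<open>The cyclic predecessor of \<open>i\<close>; length at least 3 keeps it different
    from the successor \<open>j\<close>.\<close>
  define h where "h = (if i = 0 then ?l - 1 else i - 1)"
  have h: "h < ?l" "Suc h mod ?l = i"
    using i l by (auto simp: h_def)
  have j: "j < ?l"
    unfolding j_def using l by (intro mod_less_divisor) linarith
  have "j \<noteq> i" "h \<noteq> i" "h \<noteq> j"
    using i l by (auto simp: h_def j_def mod_Suc)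
  then show thesis
    using that[of "xs ! j" "xs ! h"] E[OF i(1)] E[OF h(1)] h j i d
    by (simp add: nth_eq_iff_index_eq j_def insert_commute)
qed

text \<open>The new vertex has only the neighbour \<open>u\<close>, so no cycle passes through it,
  and a cycle avoiding it would already lie in \<open>F\<close>.\<close>

lemma tree_add_leaf:
  assumes "tree (Graph U F)" "u \<in> U" "v \<notin> U"
  shows "tree (Graph (insert v U) (insert {u, v} F))"
proof -
  have simp: "finite U" "\<And>e. e \<in> F \<Longrightarrow> e \<subseteq> U \<and> card e = 2"
    using assms(1) by (auto simp: tree_def simple_graph_def)
  let ?r = "{(x, y). {x, y} \<in> F}" and ?r' = "{(x, y). {x, y} \<in> insert {u, v} F}"
  have mono: "?r\<^sup>* \<subseteq> ?r'\<^sup>*"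
    by (rule rtrancl_mono) auto
  have con: "\<And>x y. x \<in> U \<Longrightarrow> y \<in> U \<Longrightarrow> (x, y) \<in> ?r'\<^sup>*"
    using assms(1) mono by (auto simp: tree_def connected_def)
  have uv: "(u, v) \<in> ?r'" "(v, u) \<in> ?r'"
    by (auto simp: insert_commute)
  have uv: "(u, v) \<in> ?r'\<^sup>*" "(v, u) \<in> ?r'\<^sup>*"
    using uv by blast+
  have con': "(x, y) \<in> ?r'\<^sup>*" if x: "x \<in> insert v U" and y: "y \<in> insert v U" for x y
  proof -
    have "(x, u) \<in> ?r'\<^sup>*"
      using con[OF _ assms(2)] uv x by blast
    moreover have "(u, y) \<in> ?r'\<^sup>*"
      using con[OF assms(2)] uv y by blast
    ultimately show ?thesis
      by (rule rtrancl_trans)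
  qed
  have "\<not> cycle (Graph (insert v U) (insert {u, v} F)) xs" for xs
  proof
    assume c: "cycle (Graph (insert v U) (insert {u, v} F)) xs"
    show False
    proof (cases "v \<in> set xs")
      case True
      from cycle_neighbours[OF c this] obtain x y where
        "x \<noteq> y" "x \<noteq> v" "y \<noteq> v" "{v, x} \<in> insert {u, v} F" "{v, y} \<in> insert {u, v} F"
        by (metis graph.sel(2))
      then show False
        using simp(2) assms(3) by (auto simp: doubleton_eq_iff)
    next
      case False
      have "cycle (Graph U F) xs"
        unfolding cycle_def
      proof (intro conjI allI impI)
        fix i assume i: "i < length xs"
        then have "xs ! i \<in> set xs" "xs ! (Suc i mod length xs) \<in> set xs"
          by (auto intro!: nth_mem mod_less_divisor)
        then show "{xs ! i, xs ! (Suc i mod length xs)} \<in> edges (Graph U F)"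
          using c i False by (auto simp: cycle_def doubleton_eq_iff)
      qed (use c False in \<open>auto simp: cycle_def\<close>)
      then show False
        using assms(1) by (auto simp: tree_def)
    qed
  qed
  then show ?thesis
    unfolding tree_def using simp assms(2,3) con'
    by (auto simp: simple_graph_def connected_def card_insert_if)
qed

text \<open>A tree with fewer vertices than \<open>X\<close> defines a cut of \<open>X\<close>; an
  edge of \<open>R\<close> crossing the cut attaches a new leaf.\<close>

lemma linked_contains_tree:
  assumes "linked R X" "finite X" "j < card X"
  shows "\<exists>U F. U \<subseteq> X \<and> card U = Suc j \<and> F \<subseteq> R \<and> card F = j \<and> tree (Graph U F)"
  using assms(3)
proof (induction j)
  case 0
  then obtain x where "x \<in> X" by fastforce
  then show ?case
    using tree_singleton[of x] by (intro exI[of _ "{x}"] exI[of _ "{}"]) auto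
next
  case (Suc j)
  then obtain U F where UF: "U \<subseteq> X" "card U = Suc j" "F \<subseteq> R" "card F = j" "tree (Graph U F)"
    by auto
  then have "U \<noteq> {}" "U \<noteq> X"
    using Suc.prems by auto
  then obtain u v where uv: "u \<in> U" "v \<in> X - U" "{u, v} \<in> R"
    using linkedD[OF assms(1) UF(1)] by metis
  have fin: "finite U" "\<And>e. e \<in> F \<Longrightarrow> e \<subseteq> U"
    using UF(5) by (auto simp: tree_def simple_graph_def)
  then have "finite F"
    by (metis finite_Pow_iff finite_subset Pow_iff subsetI)
  moreover have "{u, v} \<notin> F"
    using fin uv by auto
  ultimately show ?case
    using UF uv fin tree_add_leaf[OF UF(5), of u v]
    by (intro exI[of _ "insert v U"] exI[of _ "insert {u, v} F"]) auto
qed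

text \<open>The first vertex of a longest path has no neighbour except the second: a neighbour off
  the path would extend it, and one further along would close a cycle.\<close>

lemma acyclic_has_leaf:
  assumes G: "simple_graph G" and ac: "\<nexists>xs. cycle G xs" and ne: "verts G \<noteq> {}"
  shows "\<exists>v\<in>verts G. degree G v \<le> 1"
proof -
  define path where "path xs \<longleftrightarrow> xs \<noteq> [] \<and> distinct xs \<and> set xs \<subseteq> verts G \<and>
    (\<forall>i. Suc i < length xs \<longrightarrow> {xs ! i, xs ! Suc i} \<in> edges G)" for xs
  have fin: "finite (verts G)"
    using G by (simp add: simple_graph_def)
  obtain x where "x \<in> verts G" using ne by auto
  then have px: "path [x]" by (simp add: path_def)
  have bound: "\<forall>xs. path xs \<longrightarrow> length xs < Suc (card (verts G))"
    using fin by (auto simp: path_def less_Suc_eq_le distinct_card[symmetric] intro: card_mono)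
  obtain xs where xs: "path xs" and max: "\<And>ys. path ys \<Longrightarrow> length ys \<le> length xs"
    using ex_has_greatest_nat[of path "[x]" length "Suc (card (verts G))"] px bound by (meson less_imp_le)
  let ?v = "hd xs"
  have v: "?v \<in> verts G" and hd: "?v = xs ! 0"
    using xs by (auto simp: path_def hd_conv_nth)
  have nb: "w = xs ! 1" if w: "{?v, w} \<in> edges G" for w
  proof (rule ccontr)
    assume ne: "w \<noteq> xs ! 1"
    have wv: "w \<in> verts G" "w \<noteq> ?v"
      using w G by (auto simp: simple_graph_def)
    show False
    proof (cases "w \<in> set xs")
      case False
      have "path (w # xs)"
        using xs False wv w hd unfolding path_def
        by (auto simp: nth_Cons insert_commute split: nat.splits)
      then show False using max by fastforce
    next
      case True
      then obtain i where i: "i < length xs" "w = xs ! i"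
        by (metis in_set_conv_nth)
      have "i \<noteq> 0" "i \<noteq> 1" using i ne wv hd by metis+
      then have i2: "2 \<le> i" by linarith
      have "cycle G (take (Suc i) xs)"
        unfolding cycle_def
      proof (intro conjI allI impI)
        fix j assume j: "j < length (take (Suc i) xs)"
        show "{take (Suc i) xs ! j, take (Suc i) xs ! (Suc j mod length (take (Suc i) xs))} \<in> edges G"
        proof (cases "j = i")
          case True
          then show ?thesis using i w hd by (simp add: insert_commute)
        next
          case False
          then show ?thesis using i j xs by (auto simp: path_def)
        qed
      qed (use i i2 xs in \<open>auto simp: path_def dest: in_set_takeD\<close>)
      then show False using ac by blast
    qed
  qed
  have "{e \<in> edges G. ?v \<in> e} \<subseteq> {{?v, xs ! 1}}"
  proof
    fix e assume e: "e \<in> {e \<in> edges G. ?v \<in> e}"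
    then have "card e = 2" using G by (auto simp: simple_graph_def)
    then obtain a b where "e = {a, b}" by (auto simp: card_2_iff)
    then obtain w where "e = {?v, w}" using e by auto
    then show "e \<in> {{?v, xs ! 1}}" using nb e by auto
  qed
  then have "card {e \<in> edges G. ?v \<in> e} \<le> card {{?v, xs ! 1}}"
    by (intro card_mono) auto
  then show ?thesis using v by (auto simp: degree_def)
qed

lemma simple_graph_finite_edges: "simple_graph G \<Longrightarrow> finite (edges G)"
  unfolding simple_graph_def by (metis Pow_iff finite_Pow_iff finite_subset subsetI)

text \<open>Ensures that a tree with \<open>q\<close> edges has more than \<open>q\<close> vertices;
  the induction deletes a vertex of degree at most one.\<close>

lemma acyclic_card_edges:
  assumes "simple_graph G" "\<nexists>xs. cycle G xs" "verts G \<noteq> {}"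
  shows "card (edges G) < card (verts G)"
  using assms
proof (induction "card (verts G)" arbitrary: G)
  case 0
  then show ?case by (auto simp: simple_graph_def)
next
  case (Suc n)
  obtain v where v: "v \<in> verts G" "degree G v \<le> 1"
    using acyclic_has_leaf Suc.prems by blast
  let ?H = "delete_vertex G v"
  have fin: "finite (verts G)" "finite (edges G)"
    using Suc.prems simple_graph_finite_edges by (auto simp: simple_graph_def)
  have "edges G = edges ?H \<union> {e \<in> edges G. v \<in> e}"
    by (auto simp: delete_vertex_def)
  then have le: "card (edges G) \<le> card (edges ?H) + 1"
    using v(2) card_Un_le[of "edges ?H" "{e \<in> edges G. v \<in> e}"] by (simp add: degree_def)
  have card: "card (verts ?H) = n"
    using Suc.hyps v fin by (simp add: delete_vertex_def)
  show ?case
  proof (cases "verts ?H = {}")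
    case True
    then have "verts G = {v}" using v by (auto simp: delete_vertex_def)
    then have "edges G = {}"
      using Suc.prems(1) by (force simp: simple_graph_def dest: card_mono[rotated])
    then show ?thesis using v fin by (simp add: card_gt_0_iff \<open>verts G = {v}\<close>)
  next
    case False
    have "simple_graph ?H"
      using Suc.prems(1) by (auto simp: simple_graph_def delete_vertex_def)
    moreover have "\<nexists>xs. cycle ?H xs"
      using Suc.prems(2) by (auto simp: cycle_def delete_vertex_def)
    ultimately have "card (edges ?H) < card (verts ?H)"
      using Suc.hyps(1)[of ?H] card False by simp
    then show ?thesis using le card Suc.hyps(2) by simp
  qed
qed

text \<open>Transport along injections links the trees inside \<open>G\<close> to the members of
  \<open>trees_with_edges\<close>, whose vertices are natural numbers. A cycle in the image is
  pulled back by the inverse.\<close>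

lemma tree_image:
  assumes T: "tree T" and f: "inj_on f (verts T)"
  shows "tree (Graph (f ` verts T) ((`) f ` edges T))" (is "tree ?G")
proof -
  have E: "\<And>e. e \<in> edges T \<Longrightarrow> e \<subseteq> verts T \<and> card e = 2"
    using T by (auto simp: tree_def simple_graph_def)
  have "simple_graph ?G"
    using T f by (auto simp: tree_def simple_graph_def card_image inj_on_subset)
  moreover have "(f u, f v) \<in> {(x, y). {x, y} \<in> edges ?G}\<^sup>*"
    if "(u, v) \<in> {(x, y). {x, y} \<in> edges T}\<^sup>*" for u v
    using that
  proof (induction rule: rtrancl_induct)
    case (step y z)
    then have "f ` {y, z} \<in> edges ?G"
      by (simp only: graph.sel) blast
    then have "(f y, f z) \<in> {(x, y). {x, y} \<in> edges ?G}" by simp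
    with step.IH show ?case by (rule rtrancl_into_rtrancl)
  qed simp
  then have "connected ?G"
    using T by (auto simp: tree_def connected_def)
  moreover have "\<not> cycle ?G xs" for xs
  proof
    assume c: "cycle ?G xs"
    let ?g = "inv_into (verts T) f"
    have gi: "inj_on ?g (set xs)"
      using c by (intro inj_on_inv_into) (auto simp: cycle_def)
    have "cycle T (map ?g xs)"
      unfolding cycle_def
    proof (intro conjI allI impI)
      fix i assume "i < length (map ?g xs)"
      then have i: "i < length xs" "Suc i mod length xs < length xs"
        by (auto intro: mod_less_divisor)
      then obtain e where e: "e \<in> edges T" "{xs ! i, xs ! (Suc i mod length xs)} = f ` e"
        using c by (auto simp: cycle_def)
      have "?g ` f ` e = e"
        using E[OF e(1)] f by (simp add: inv_into_image_cancel)
      then have "{?g (xs ! i), ?g (xs ! (Suc i mod length xs))} = e"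
        using e(2) by (metis image_empty image_insert)
      then show "{map ?g xs ! i, map ?g xs ! (Suc i mod length (map ?g xs))} \<in> edges T"
        using i e by simp
    next
      show "set (map ?g xs) \<subseteq> verts T"
        using c by (auto simp: cycle_def intro: inv_into_into)
    qed (use c gi in \<open>auto simp: cycle_def distinct_map\<close>)
    then show False using T by (auto simp: tree_def)
  qed
  ultimately show ?thesis by (auto simp: tree_def)
qed

lemma inj_on_image_edges:
  assumes "simple_graph G" "inj_on f (verts G)"
  shows "inj_on ((`) f) (edges G)"
  by (rule inj_on_subset[OF inj_on_image_Pow[OF assms(2)]])
     (use assms(1) in \<open>auto simp: simple_graph_def\<close>)

lemma isomorphic_tree:
  assumes "simple_graph H" "tree F" "isomorphic H F"
  shows "tree H" "card (edges H) = card (edges F)"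
proof -
  obtain f where f: "bij_betw f (verts H) (verts F)" "edges F = (\<lambda>e. f ` e) ` edges H"
    using assms(3) by (auto simp: isomorphic_def)
  let ?g = "inv_into (verts H) f"
  have "?g ` verts F = verts H"
    using f(1) by (meson bij_betw_def bij_betw_inv_into)
  moreover have "?g ` f ` e = e" if "e \<in> edges H" for e
    using that assms(1) f(1) by (auto simp: bij_betw_def simple_graph_def inv_into_image_cancel)
  then have "(`) ?g ` edges F = edges H"
    by (force simp: f(2) image_iff)
  moreover have "inj_on ?g (verts F)"
    using f(1) bij_betw_inv_into bij_betw_def by blast
  ultimately show "tree H"
    using tree_image[OF assms(2), of ?g] by simp
  show "card (edges H) = card (edges F)"
    unfolding f(2) using f(1) assms(1)
    by (metis card_image inj_on_image_edges bij_betw_def)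
qed

lemma tree_isomorphic_nat:
  assumes "tree T"
  shows "\<exists>F \<in> trees_with_edges (card (edges T)). isomorphic T F"
proof -
  have s: "simple_graph T" "finite (verts T)"
    using assms by (auto simp: tree_def simple_graph_def)
  obtain f :: "'a \<Rightarrow> nat" where f: "inj_on f (verts T)"
    using s finite_imp_inj_to_nat_seg by blast
  let ?F = "Graph (f ` verts T) ((`) f ` edges T)"
  have "?F \<in> trees_with_edges (card (edges T))"
    using tree_image[OF assms f] inj_on_image_edges[OF s(1) f]
    by (simp add: trees_with_edges_def card_image)
  moreover have "isomorphic T ?F"
    using f by (auto simp: isomorphic_def bij_betw_def)
  ultimately show ?thesis by blast
qed

section \<open>Separating a rainbow subgraph\<close>

text \<open>A linked set with more than \<open>q\<close> vertices contains a tree with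
  \<open>q\<close> edges from \<open>R\<close>, which is rainbow because \<open>c\<close> is
  injective on \<open>R\<close>.\<close>

lemma rainbow_free_linked:
  assumes free: "rainbow_free G (trees_with_edges q) c"
    and G: "simple_graph G" and R: "R \<subseteq> edges G" "inj_on c R" and X: "X \<subseteq> verts G" "linked R X"
  shows "card X \<le> q"
proof (rule ccontr)
  assume "\<not> card X \<le> q"
  moreover have "finite X"
    using X(1) G by (auto simp: simple_graph_def intro: finite_subset)
  ultimately obtain U F where UF: "U \<subseteq> X" "F \<subseteq> R" "card F = q" "tree (Graph U F)"
    using linked_contains_tree[OF X(2), of q] by auto
  then obtain T where "T \<in> trees_with_edges q" "isomorphic (Graph U F) T"
    using tree_isomorphic_nat[of "Graph U F"] by auto
  moreover have "subgraph (Graph U F) G" "rainbow c (Graph U F)"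
    using UF R X by (auto simp: subgraph_def tree_def rainbow_def intro: inj_on_subset)
  ultimately show False
    using free unfolding rainbow_free_def by blast
qed

text \<open>The resulting \<open>R\<close> consists of one edge of each colour, except for one
  deleted edge \<open>e\<close>; hence \<open>Suc (card R)\<close>. Since \<open>e\<close> is a
  bridge of a largest linked set \<open>W\<close>, a linked set of the rest lies in one side of the
  bridge or outside \<open>W\<close>.\<close>

lemma rainbow_linked_max_split:
  fixes V :: "'a set" and E :: "'a set set" and c :: "'a set \<Rightarrow> nat"
  assumes fin: "finite V" and E: "\<And>e. e \<in> E \<Longrightarrow> e \<subseteq> V \<and> card e = 2" and conn: "linked E V"
    and adj: "\<And>w D. w \<in> V \<Longrightarrow> D \<subseteq> V \<Longrightarrow> linked E D \<Longrightarrow> w \<notin> D \<Longrightarrow> 2 \<le> card D \<Longrightarrow> \<exists>v\<in>D. {w, v} \<in> E"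
    and bound: "\<And>R X. R \<subseteq> E \<Longrightarrow> inj_on c R \<Longrightarrow> X \<subseteq> V \<Longrightarrow> linked R X \<Longrightarrow> card X \<le> q"
    and q: "2 \<le> q" "q < card V"
  shows "\<exists>R \<subseteq> E. Suc (card R) = card (c ` E) \<and> \<not> linked R V \<and>
    (\<forall>X Y. X \<subseteq> V \<longrightarrow> Y \<subseteq> V \<longrightarrow> X \<inter> Y = {} \<longrightarrow> linked R X \<longrightarrow> linked R Y \<longrightarrow> card X + card Y \<le> q)"
proof -
  have finE: "finite E"
    using fin E by (meson Pow_iff finite_Pow_iff finite_subset subsetI)
  define rep where "rep R \<longleftrightarrow> R \<subseteq> E \<and> inj_on c R \<and> c ` R = c ` E" for R
  define P where "P = (\<lambda>(R, W). rep R \<and> W \<subseteq> V \<and> linked R W)"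
  obtain R0 where R0: "rep R0"
    using subset_image_inj[of "c ` E" c E] unfolding rep_def by auto
  obtain v0 where "v0 \<in> V"
    using linked_nonempty[OF conn] by auto
  then have P0: "P (R0, {v0})"
    using R0 by (simp add: P_def linked_singleton)
  have "\<exists>x. P x \<and> (\<forall>y. P y \<longrightarrow> card (snd y) \<le> card (snd x))"
    using ex_has_greatest_nat[of P "(R0, {v0})" "\<lambda>x. card (snd x)" "Suc (card V)"] P0 fin
    by (auto simp: P_def card_mono less_Suc_eq_le)
  then obtain R W where RW: "rep R" "W \<subseteq> V" "linked R W"
    and max: "\<And>R' X. rep R' \<Longrightarrow> X \<subseteq> V \<Longrightarrow> linked R' X \<Longrightarrow> card X \<le> card W"
    unfolding P_def by auto
  have R: "R \<subseteq> E" "inj_on c R" "c ` R = c ` E"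
    using RW(1) by (auto simp: rep_def)
  have finR: "finite R" using R finE finite_subset by blast
  have finV: "finite X" if "X \<subseteq> V" for X
    using that fin finite_subset by blast
  have Wq: "card W \<le> q"
    using bound[OF R(1,2) RW(2,3)] .
  have exch: "rep (insert f (R - {e}))" if "e \<in> R" "f \<in> E" "c f = c e" for e f
    unfolding rep_def
  proof (intro conjI)
    show "insert f (R - {e}) \<subseteq> E" using that R by auto
    show "inj_on c (insert f (R - {e}))"
      using that R(2) by (auto simp: inj_on_def)
    show "c ` insert f (R - {e}) = c ` E"
      using that R(3) by auto
  qed
  have out: "w \<notin> W \<or> v \<in> W" if "{w, v} \<in> R" for w v
  proof (rule ccontr)
    assume "\<not> ?thesis"
    then have wv: "w \<in> W" "v \<notin> W" by auto
    have "v \<in> V" using E[of "{w, v}"] R(1) that by auto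
    then have "card (insert v W) \<le> card W"
      using max[OF RW(1), of "insert v W"] linked_insert_edge[OF RW(3) wv(1) that] RW(2) by auto
    then show False using wv finV[OF RW(2)] by simp
  qed
  have inside: "X \<subseteq> W \<or> X \<inter> W = {}" if X: "linked R X" for X
  proof (rule ccontr)
    assume "\<not> ?thesis"
    then have "X \<inter> W \<noteq> {}" "X \<inter> W \<noteq> X" by auto
    then obtain u v where "u \<in> X \<inter> W" "v \<in> X - X \<inter> W" "{u, v} \<in> R"
      using linkedD[OF X, of "X \<inter> W"] by blast
    then show False using out[of u v] by auto
  qed
  \<comment> \<open>Exchange the representative \<open>e\<close> of the colour of
    \<open>{w, v}\<close> for that edge. If \<open>W\<close> stayed linked, it would grow by
    \<open>v\<close>; so \<open>e\<close> is a bridge. The side \<open>A\<close> of \<open>w\<close>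
    joined with \<open>D\<close> is not larger than \<open>W\<close>, which leaves
    \<open>card D \<le> card B\<close>.\<close>
  have far: "\<exists>e A B. splits R W e A B \<and> w \<in> A \<and> card D \<le> card B"
    if f: "{w, v} \<in> E" "w \<in> W" "v \<in> D" and D: "D \<subseteq> V - W" "linked R D" for w v D
  proof -
    obtain e where e: "e \<in> R" "c {w, v} = c e"
      using f R by (metis imageE imageI)
    let ?R = "insert {w, v} (R - {e})"
    have rep: "rep ?R" using exch[OF e(1) f(1)] e(2) by simp
    have finW: "finite W" "finite D" using finV RW D by auto
    have ne: "\<not> linked (R - {e}) W"
    proof
      assume "linked (R - {e}) W"
      then have "linked ?R W" by (rule linked_mono) auto
      then have "linked ?R (insert v W)"
        using f by (intro linked_insert_edge[of _ W w]) auto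
      moreover have "v \<in> V - W" using f D by auto
      ultimately have "card (insert v W) \<le> card W"
        using max[OF rep, of "insert v W"] RW(2) by auto
      then show False using \<open>v \<in> V - W\<close> finW by simp
    qed
    obtain A0 B0 where AB0: "splits R W e A0 B0"
      using bridge_splits[OF RW(3) ne] .
    then have "w \<in> A0 \<or> w \<in> B0"
      using f(2) by (auto simp: splits_def)
    then obtain A B where AB: "splits R W e A B" "w \<in> A"
      using AB0 splits_sym by blast
    then have s: "W = A \<union> B" "A \<inter> B = {}" "linked (R - {e}) A"
      by (auto simp: splits_def)
    have eW: "e \<subseteq> W"
      using AB(1) by (auto simp: splits_def)
    have "linked ?R D"
    proof (rule linked_cong_subset[OF D(2)])
      show "{x, y} \<in> ?R" if "x \<in> D" "y \<in> D" "{x, y} \<in> R" for x y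
        using that eW D(1) by auto
    qed
    moreover have "linked ?R A"
      by (rule linked_mono[OF s(3)]) auto
    ultimately have "linked ?R (A \<union> D)"
      using AB(2) f by (intro linked_Un_edge[of _ A D w v]) auto
    then have "card (A \<union> D) \<le> card W"
      using max[OF rep, of "A \<union> D"] RW(2) s D by auto
    moreover have "card (A \<union> D) = card A + card D"
      using s D finW by (intro card_Un_disjoint) auto
    moreover have "card W = card A + card B"
      using s finW by (simp add: card_Un_disjoint)
    ultimately show ?thesis using AB by auto
  qed
  have bridge: "\<exists>e A B. splits R W e A B \<and> card D \<le> card A \<and> card D \<le> card B"
    if D: "D \<subseteq> V - W" "linked R D" and to: "\<And>w. w \<in> W \<Longrightarrow> \<exists>v\<in>D. {w, v} \<in> E" for D
  proof -
    have far': "\<exists>e A B. splits R W e A B \<and> w \<in> A \<and> card D \<le> card B" if "w \<in> W" for w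
      using to[OF that] far[OF _ that _ D] by blast
    obtain w where "w \<in> W" using linked_nonempty[OF RW(3)] by auto
    txt \<open>Take a bridge with \<open>card D \<le> card B\<close> and \<open>B\<close> smallest. The bridge obtained in the same way from
      its endpoint in \<open>B\<close> cannot have its far side inside \<open>B\<close>, so that side lies in \<open>A\<close>.\<close>
    then obtain e0 A0 B0 where "splits R W e0 A0 B0" "card D \<le> card B0"
      using far' by blast
    then obtain e A B where AB: "splits R W e A B" "card D \<le> card B"
      and min: "\<And>e' A' B'. splits R W e' A' B' \<Longrightarrow> card D \<le> card B' \<Longrightarrow> card B \<le> card B'"
      using ex_has_least_nat[of "\<lambda>(e, A, B). splits R W e A B \<and> card D \<le> card B" "(e0, A0, B0)"
          "\<lambda>(e, A, B). card B"] by auto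
    have s: "W = A \<union> B" "A \<inter> B = {}" and only: "\<And>x y. x \<in> A \<Longrightarrow> y \<in> B \<Longrightarrow> {x, y} \<in> R \<Longrightarrow> {x, y} = e"
      using AB by (auto simp: splits_def)
    obtain a b where ab: "a \<in> A" "b \<in> B" "e = {a, b}"
      using AB by (auto simp: splits_def)
    obtain e' A' B' where AB': "splits R W e' A' B'" "b \<in> A'" "card D \<le> card B'"
      using far'[of b] ab s by auto
    have s': "W = A' \<union> B'" "A' \<inter> B' = {}" "linked (R - {e'}) B'"
      using AB' by (auto simp: splits_def)
    have "B' \<subseteq> A"
    proof (rule ccontr)
      assume nA: "\<not> B' \<subseteq> A"
      have nB: "\<not> B' \<subseteq> B"
      proof
        assume "B' \<subseteq> B"
        then have "B' \<subset> B" using ab AB' s' by auto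
        then have "card B' < card B"
          using s finV[OF RW(2)] by (intro psubset_card_mono) auto
        then show False using min[OF AB'(1,3)] by simp
      qed
      then have "B' \<inter> A \<noteq> {}" "B' \<inter> A \<noteq> B'" using nA s s' by auto
      then obtain x y where xy: "x \<in> B' \<inter> A" "y \<in> B' - B' \<inter> A" "{x, y} \<in> R - {e'}"
        using linkedD[OF s'(3), of "B' \<inter> A"] by blast
      then have "{x, y} = {a, b}" using only[of x y] s s' ab by auto
      then have "b \<in> B'" using xy ab s by (auto simp: doubleton_eq_iff)
      then show False using AB' s' by auto
    qed
    then have "card B' \<le> card A"
      using s finV[OF RW(2)] by (intro card_mono) auto
    then have "card D \<le> card A" using AB'(3) by simp
    then show ?thesis using AB by blast
  qed
  have WV: "W \<noteq> V" using Wq q by auto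
  \<comment> \<open>\<open>d\<close> bounds the linked sets outside \<open>W\<close>. A single
    vertex need not be adjacent to all of \<open>W\<close>, so \<open>bridge\<close> is applied only
    if some linked set outside has two vertices; otherwise \<open>d = 1\<close>, and any bridge from
    \<open>far\<close> will do since both sides are nonempty.\<close>
  have "\<exists>e A B d. splits R W e A B \<and> (d = 1 \<or> d \<le> card A \<and> d \<le> card B) \<and>
     (\<forall>X \<subseteq> V - W. linked R X \<longrightarrow> card X \<le> d)"
  proof (cases "\<exists>D \<subseteq> V - W. linked R D \<and> 2 \<le> card D")
    case True
    then obtain D0 where D0: "D0 \<subseteq> V - W \<and> linked R D0 \<and> 2 \<le> card D0" by auto
    have "\<forall>X. X \<subseteq> V - W \<and> linked R X \<and> 2 \<le> card X \<longrightarrow> card X < Suc (card V)"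
      using fin by (auto simp: less_Suc_eq_le intro: card_mono)
    from ex_has_greatest_nat[where P = "\<lambda>D. D \<subseteq> V - W \<and> linked R D \<and> 2 \<le> card D", OF D0 this]
    obtain D where D': "D \<subseteq> V - W \<and> linked R D \<and> 2 \<le> card D"
      "\<forall>X. X \<subseteq> V - W \<and> linked R X \<and> 2 \<le> card X \<longrightarrow> card X \<le> card D" by metis
    then have D: "D \<subseteq> V - W" "linked R D" "2 \<le> card D"
      and Dmax: "\<And>X. X \<subseteq> V - W \<Longrightarrow> linked R X \<Longrightarrow> 2 \<le> card X \<Longrightarrow> card X \<le> card D"
      by auto
    have "\<exists>v\<in>D. {w, v} \<in> E" if "w \<in> W" for w
      using that RW(2) D R(1) by (intro adj) (auto intro: linked_mono)
    then obtain e A B where "splits R W e A B" "card D \<le> card A" "card D \<le> card B"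
      using bridge[OF D(1,2)] by blast
    moreover have "card X \<le> card D" if "X \<subseteq> V - W" "linked R X" for X
      using Dmax[OF that] D(3) by linarith
    ultimately show ?thesis by blast
  next
    case False
    obtain w v where wv: "w \<in> W" "v \<in> V - W" "{w, v} \<in> E"
      using linkedD[OF conn RW(2) linked_nonempty[OF RW(3)] WV] .
    then obtain e A B where "splits R W e A B"
      using far[OF wv(3,1), of "{v}"] linked_singleton[of R v] wv(2) by blast
    moreover have "card X \<le> 1" if "X \<subseteq> V - W" "linked R X" for X
      using False that by (metis Suc_1 not_less_eq_eq)
    ultimately show ?thesis by blast
  qed
  then obtain e A B d where AB: "splits R W e A B" and d: "d = 1 \<or> d \<le> card A \<and> d \<le> card B"
    and small: "\<And>X. X \<subseteq> V - W \<Longrightarrow> linked R X \<Longrightarrow> card X \<le> d"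
    by blast
  have s: "W = A \<union> B" "A \<inter> B = {}" "A \<noteq> {}" "B \<noteq> {}" "e \<in> R"
    using AB linked_nonempty by (auto simp: splits_def)
  have finAB: "finite A" "finite B" using finV[OF RW(2)] s by auto
  have cW: "card W = card A + card B" "0 < card A" "0 < card B"
    using s finAB by (simp_all add: card_Un_disjoint card_gt_0_iff)
  let ?R = "R - {e}"
  have tri: "X \<subseteq> A \<or> X \<subseteq> B \<or> X \<inter> W = {} \<and> card X \<le> d" if X: "X \<subseteq> V" "linked ?R X" for X
  proof -
    have "linked R X" by (rule linked_mono[OF X(2)]) auto
    then show ?thesis
      using inside[of X] linked_in_side[OF AB X(2)] small[of X] X(1) by blast
  qed
  have le: "card X \<le> card A \<or> card X \<le> card B \<or> card X \<le> d" if "X \<subseteq> V" "linked ?R X" for X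
    using tri[OF that] finAB card_mono by metis
  \<comment> \<open>A set outside \<open>W\<close> has at most \<open>d\<close> vertices and is paid
    for by the side of the bridge that the other set does not use. Two sets outside \<open>W\<close>
    fit into the two sides or, for \<open>d = 1\<close>, are covered by
    \<open>2 \<le> q\<close>.\<close>
  have pair: "card X + card Y \<le> q"
    if X: "X \<subseteq> V" "linked ?R X" and Y: "Y \<subseteq> V" "linked ?R Y" and XY: "X \<inter> Y = {}" for X Y
  proof (cases "X \<subseteq> W \<and> Y \<subseteq> W")
    case True
    then have "card (X \<union> Y) \<le> card W"
      using finV[OF RW(2)] by (intro card_mono) auto
    moreover have "card (X \<union> Y) = card X + card Y"
      using XY finV X Y by (intro card_Un_disjoint) auto
    ultimately show ?thesis using Wq by simp
  next
    case False
    then have "card X \<le> d \<or> card Y \<le> d"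
      using tri[OF X] tri[OF Y] s by blast
    then show ?thesis
      using le[OF X] le[OF Y] d cW Wq q(1) by linarith
  qed
  moreover have "\<not> linked ?R V"
  proof
    assume "linked ?R V"
    then have "V \<subseteq> A \<or> V \<subseteq> B \<or> V \<inter> W = {}"
      using tri[of V] by auto
    then show False using RW(2) s by blast
  qed
  moreover have "Suc (card ?R) = card (c ` E)"
    using s(5) R finR by (metis card_Suc_Diff1 card_image)
  ultimately show ?thesis
    using R(1) by (intro exI[of _ ?R]) blast
qed

section \<open>Colourings for the lower bound\<close>

text \<open>A rainbow tree has at most one edge \<open>{x, y}\<close> outside \<open>R0\<close>, so
  its vertices lie in the fibres of \<open>x\<close> and \<open>y\<close>, which are too small for
  \<open>q\<close> edges. Two partitions are used later: one large part with singletons, and cliques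
  meeting each class at most once.\<close>

lemma fibre_coloring:
  fixes \<pi> :: "'a \<Rightarrow> 'b"
  assumes G: "simple_graph G"
    and R0: "R0 = {e \<in> edges G. \<forall>x\<in>e. \<forall>y\<in>e. \<pi> x = \<pi> y}" and ne: "R0 \<noteq> edges G"
    and small: "\<And>x y. x \<in> verts G \<Longrightarrow> y \<in> verts G \<Longrightarrow> card {v \<in> verts G. \<pi> v = \<pi> x \<or> \<pi> v = \<pi> y} \<le> q"
  shows "\<exists>c. edge_coloring G (Suc (card R0)) c \<and> rainbow_free G (trees_with_edges q) c"
proof -
  have finE: "finite (edges G)" using G by (rule simple_graph_finite_edges)
  then have "finite R0" using R0 by simp
  then obtain h where h: "bij_betw h R0 {1..card R0}"
    using ex_bij_betw_nat_finite_1 bij_betw_inv by blast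
  define c where "c e = (if e \<in> R0 then h e else Suc (card R0))" for e
  have "c ` edges G = h ` R0 \<union> {Suc (card R0)}"
    using ne R0 by (auto simp: c_def image_iff)
  also have "\<dots> = {1..Suc (card R0)}"
    using h by (auto simp: bij_betw_def)
  finally have "edge_coloring G (Suc (card R0)) c" by (simp add: edge_coloring_def)
  moreover have "rainbow_free G (trees_with_edges q) c"
    unfolding rainbow_free_def
  proof safe
    fix H F assume H: "subgraph H G" "F \<in> trees_with_edges q" "isomorphic H F" "rainbow c H"
    have sH: "simple_graph H" and sub: "verts H \<subseteq> verts G" "edges H \<subseteq> edges G"
      using H(1) by (auto simp: subgraph_def)
    have T: "tree H" "card (edges H) = q"
      using isomorphic_tree[OF sH _ H(3)] H(2) by (auto simp: trees_with_edges_def)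
    then have big: "q < card (verts H)"
      using acyclic_card_edges[of H] by (auto simp: tree_def connected_def)
    have one: "e = e'" if "e \<in> edges H - R0" "e' \<in> edges H - R0" for e e'
      using H(4) that by (auto simp: rainbow_def inj_on_def c_def)
    \<comment> \<open>Without an edge of the extra colour, the tree stays in one fibre and any
      vertex serves as both \<open>x\<close> and \<open>y\<close>.\<close>
    have "\<exists>x\<in>verts H. \<exists>y\<in>verts H. \<forall>e\<in>edges H. e \<in> R0 \<or> e = {x, y}"
    proof (cases "edges H \<subseteq> R0")
      case True
      moreover obtain x where "x \<in> verts H"
        using T(1) by (auto simp: tree_def connected_def)
      ultimately show ?thesis by blast
    next
      case False
      then obtain e where e: "e \<in> edges H - R0" by auto
      then have "card e = 2" "e \<subseteq> verts H" using sH by (auto simp: simple_graph_def)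
      then obtain x y where "e = {x, y}" "x \<in> verts H" "y \<in> verts H"
        by (auto simp: card_2_iff)
      then show ?thesis using one[OF e] by blast
    qed
    then obtain x y where xy: "x \<in> verts H" "y \<in> verts H" "\<And>e. e \<in> edges H \<Longrightarrow> e \<in> R0 \<or> e = {x, y}"
      by blast
    have "\<pi> u = \<pi> x \<or> \<pi> u = \<pi> y" if "(x, u) \<in> {(x, y). {x, y} \<in> edges H}\<^sup>*" for u
      using that
    proof (induction rule: rtrancl_induct)
      case (step u v)
      then have "{u, v} \<in> R0 \<or> {u, v} = {x, y}" using xy(3)[of "{u, v}"] by auto
      then show ?case
      proof
        assume "{u, v} \<in> R0"
        then have "\<pi> u = \<pi> v" unfolding R0 by blast
        then show ?thesis using step.IH by simp
      qed (auto simp: doubleton_eq_iff)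
    qed simp
    moreover have "(x, u) \<in> {(x, y). {x, y} \<in> edges H}\<^sup>*" if "u \<in> verts H" for u
      using T(1) xy(1) that by (simp add: tree_def connected_def)
    ultimately have "verts H \<subseteq> {v \<in> verts G. \<pi> v = \<pi> x \<or> \<pi> v = \<pi> y}"
      using sub by blast
    then have "card (verts H) \<le> card {v \<in> verts G. \<pi> v = \<pi> x \<or> \<pi> v = \<pi> y}"
      using G by (intro card_mono) (auto simp: simple_graph_def)
    then show False using big small[of x y] xy sub by force
  qed
  ultimately show ?thesis by blast
qed

lemma ar_eqI:
  assumes G: "simple_graph G"
    and ex: "\<exists>c. edge_coloring G t c \<and> rainbow_free G \<C> c"
    and up: "\<And>s c. edge_coloring G s c \<Longrightarrow> rainbow_free G \<C> c \<Longrightarrow> s \<le> t"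
  shows "ar G \<C> = t"
proof -
  let ?T = "{t. \<exists>c. edge_coloring G t c \<and> rainbow_free G \<C> c}"
  have "?T \<subseteq> {..t}" using up by auto
  then have "finite ?T" using finite_subset by blast
  then have "Max ?T = t" using ex up by (intro Max_eqI) auto
  moreover have "?T \<noteq> {}" using ex by blast
  ultimately show ?thesis unfolding ar_def Let_def by auto
qed

section \<open>Complete multipartite graphs\<close>

text \<open>Classes are numbered from 0 by nonincreasing size, so \<open>s i\<close> stands for the
  part of index \<open>i + 1\<close> in the theorem.\<close>

locale multipartite =
  fixes s :: "nat \<Rightarrow> nat" and k :: nat
  assumes two_classes: "2 \<le> k"
    and antitone: "\<And>i j. i \<le> j \<Longrightarrow> j < k \<Longrightarrow> s j \<le> s i"
    and pos: "\<And>i. i < k \<Longrightarrow> 1 \<le> s i"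
begin

definition V :: "(nat \<times> nat) set" where
  "V = Sigma {..<k} (\<lambda>i. {..<s i})"

definition E :: "(nat \<times> nat) set set" where
  "E = {{u, v} | u v. u \<in> V \<and> v \<in> V \<and> fst u \<noteq> fst v}"

definition N :: nat where
  "N = (\<Sum>i<k. s i)"

definition induced_edges :: "(nat \<times> nat) set \<Rightarrow> (nat \<times> nat) set set" where
  "induced_edges X = {e \<in> E. e \<subseteq> X}"

definition class_size :: "(nat \<times> nat) set \<Rightarrow> nat \<Rightarrow> nat" where
  "class_size X i = card {v \<in> X. fst v = i}"

text \<open>The largest size of a vertex set with at most \<open>l\<close> vertices in each class;
  \<open>level\<close> inverts it.\<close>

definition capped_sum :: "nat \<Rightarrow> nat" where
  "capped_sum l = (\<Sum>i<k. min (s i) l)"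

definition level :: "nat \<Rightarrow> nat" where
  "level j = (LEAST l. j \<le> capped_sum l)"

text \<open>A set of \<open>j\<close> vertices meets some class in at least \<open>level j\<close> vertices, so this is the
  largest minimum degree of an induced subgraph on \<open>j\<close> vertices.\<close>

definition max_min_degree :: "nat \<Rightarrow> nat" where
  "max_min_degree j = j - level j"

text \<open>For \<open>j \<le> N\<close> this is the largest number of edges on \<open>j\<close>
  vertices, by \<open>card_induced_le\<close> and \<open>balanced_card_induced\<close>. As a purely
  numerical sum it does not depend on how the greedy procedure breaks ties.\<close>

definition max_edges :: "nat \<Rightarrow> nat" where
  "max_edges j = (\<Sum>i=1..j. max_min_degree i)"

lemma V_iff: "(i, a) \<in> V \<longleftrightarrow> i < k \<and> a < s i"
  by (auto simp: V_def)

lemma finite_V: "finite V"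
  by (simp add: V_def)

lemma card_V: "card V = N"
  by (simp add: V_def N_def)

lemma edge_iff: "{u, v} \<in> E \<longleftrightarrow> u \<in> V \<and> v \<in> V \<and> fst u \<noteq> fst v"
  unfolding E_def mem_Collect_eq doubleton_eq_iff by metis

lemma edgeE:
  assumes "e \<in> E"
  obtains u v where "e = {u, v}" "u \<in> V" "v \<in> V" "fst u \<noteq> fst v"
  using assms by (auto simp: E_def)

lemma edge_subset: "e \<in> E \<Longrightarrow> e \<subseteq> V \<and> card e = 2"
  by (erule edgeE) auto

lemma simple_graph_VE: "simple_graph (Graph V E)"
  using edge_subset by (auto simp: simple_graph_def finite_V)

lemma finite_E: "finite E"
  using simple_graph_finite_edges[OF simple_graph_VE] by simp

lemma finite_induced: "finite (induced_edges X)"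
  using finite_E by (simp add: induced_edges_def)

lemma induced_empty: "induced_edges {} = {}"
  using edge_subset by (force simp: induced_edges_def)

lemma vertex_class: "v \<in> V \<Longrightarrow> fst v < k"
  by (auto simp: V_def)

lemma class_size_V: "i < k \<Longrightarrow> class_size V i = s i"
proof -
  assume "i < k"
  then have "{v \<in> V. fst v = i} = {i} \<times> {..<s i}" by (auto simp: V_def)
  then show ?thesis by (simp add: class_size_def)
qed

lemma class_size_le:
  assumes "X \<subseteq> V" "i < k"
  shows "class_size X i \<le> s i"
proof -
  have "class_size X i \<le> class_size V i"
    unfolding class_size_def using assms finite_V by (intro card_mono) auto
  then show ?thesis using class_size_V[OF assms(2)] by simp
qed

lemma sum_class_size:
  assumes "X \<subseteq> V"
  shows "(\<Sum>i<k. class_size X i) = card X"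
proof -
  have "finite X" using assms finite_V finite_subset by blast
  have "X = (\<Union>i<k. {v \<in> X. fst v = i})"
    using assms vertex_class by auto
  then have "card X = card (\<Union>i<k. {v \<in> X. fst v = i})" by simp
  also have "\<dots> = (\<Sum>i<k. class_size X i)"
    unfolding class_size_def using \<open>finite X\<close> by (intro card_UN_disjoint) auto
  finally show ?thesis by simp
qed

lemma degree_induced:
  assumes "X \<subseteq> V" "u \<in> X"
  shows "degree (Graph X (induced_edges X)) u = card X - class_size X (fst u)"
proof -
  have fin: "finite X" using assms finite_V finite_subset by blast
  have "{e \<in> induced_edges X. u \<in> e} = (\<lambda>v. {u, v}) ` {v \<in> X. fst v \<noteq> fst u}"
  proof (intro set_eqI iffI)
    fix e assume "e \<in> {e \<in> induced_edges X. u \<in> e}"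
    then have e: "e \<in> E" "e \<subseteq> X" "u \<in> e" by (auto simp: induced_edges_def)
    obtain x y where xy: "e = {x, y}" "fst x \<noteq> fst y" using edgeE[OF e(1)] by metis
    then have "u = x \<or> u = y" using e(3) by simp
    then show "e \<in> (\<lambda>v. {u, v}) ` {v \<in> X. fst v \<noteq> fst u}"
    proof
      assume "u = x"
      then show ?thesis using xy e(2) by (intro image_eqI[of _ _ y]) simp_all
    next
      assume "u = y"
      then show ?thesis using xy e(2) by (intro image_eqI[of _ _ x]) (simp_all add: insert_commute)
    qed
  next
    fix e assume "e \<in> (\<lambda>v. {u, v}) ` {v \<in> X. fst v \<noteq> fst u}"
    then obtain v where e: "e = {u, v}" and v': "v \<in> {v \<in> X. fst v \<noteq> fst u}" by (rule imageE)
    have v: "v \<in> X" "fst u \<noteq> fst v" using v' by simp_all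
    have "u \<in> V" "v \<in> V" using assms v by blast+
    then have "e \<in> E" using v(2) by (simp add: e edge_iff)
    then show "e \<in> {e \<in> induced_edges X. u \<in> e}"
      using v assms(2) by (simp add: induced_edges_def e)
  qed
  moreover have "inj_on (\<lambda>v. {u, v}) {v \<in> X. fst v \<noteq> fst u}"
    by (auto simp: inj_on_def doubleton_eq_iff)
  ultimately have "degree (Graph X (induced_edges X)) u = card {v \<in> X. fst v \<noteq> fst u}"
    by (simp add: degree_def card_image)
  also have "{v \<in> X. fst v \<noteq> fst u} = X - {v \<in> X. fst v = fst u}" by auto
  also have "card \<dots> = card X - class_size X (fst u)"
    using fin by (subst card_Diff_subset) (auto simp: class_size_def)
  finally show ?thesis .
qed

lemma delete_vertex_induced:
  "delete_vertex (Graph X (induced_edges X)) u = Graph (X - {u}) (induced_edges (X - {u}))"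
  by (auto simp: delete_vertex_def induced_edges_def)

lemma card_induced_remove:
  assumes "X \<subseteq> V" "u \<in> X"
  shows "card (induced_edges X) = card (induced_edges (X - {u})) + (card X - class_size X (fst u))"
proof -
  have "induced_edges X = induced_edges (X - {u}) \<union> {e \<in> induced_edges X. u \<in> e}"
    by (auto simp: induced_edges_def)
  moreover have "induced_edges (X - {u}) \<inter> {e \<in> induced_edges X. u \<in> e} = {}"
    by (auto simp: induced_edges_def)
  ultimately have "card (induced_edges X) =
      card (induced_edges (X - {u})) + card {e \<in> induced_edges X. u \<in> e}"
    using finite_induced by (metis (no_types, lifting) card_Un_disjoint finite_Un)
  then show ?thesis
    using degree_induced[OF assms] by (simp add: degree_def)
qed

section \<open>Capped sums, levels, and the growth of the extremal minimum degree\<close>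

lemma capped_sum_mono: "l \<le> m \<Longrightarrow> capped_sum l \<le> capped_sum m"
  unfolding capped_sum_def by (intro sum_mono) auto

lemma capped_sum_0: "capped_sum 0 = 0"
  by (simp add: capped_sum_def)

lemma capped_sum_1: "capped_sum 1 = k"
proof -
  have "capped_sum 1 = (\<Sum>i<k. 1)"
    unfolding capped_sum_def using pos by (intro sum.cong) auto
  then show ?thesis by simp
qed

lemma capped_sum_all:
  assumes "s 0 \<le> l"
  shows "capped_sum l = N"
  unfolding capped_sum_def N_def
  using assms antitone by (intro sum.cong) (auto simp: min_def intro: order_trans)

text \<open>As long as vertices are missing, the largest class is not exhausted and contributes one
  more.\<close>

lemma capped_sum_Suc: "capped_sum l < N \<Longrightarrow> capped_sum l < capped_sum (Suc l)"
proof -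
  assume "capped_sum l < N"
  then have "\<not> s 0 \<le> l" using capped_sum_all by fastforce
  then have "(\<Sum>i<k. min (s i) l) < (\<Sum>i<k. min (s i) (Suc l))"
    using two_classes by (intro sum_strict_mono_ex1) (auto intro: bexI[of _ 0])
  then show ?thesis by (simp add: capped_sum_def)
qed

lemma capped_sum_ge: "l \<le> N \<Longrightarrow> l \<le> capped_sum l"
proof (induction l)
  case (Suc l)
  then show ?case
    using capped_sum_Suc[of l] capped_sum_mono[of l "Suc l"] by linarith
qed simp

lemma level_le: "j \<le> capped_sum l \<Longrightarrow> level j \<le> l"
  unfolding level_def by (rule Least_le)

lemma capped_sum_level: "j \<le> N \<Longrightarrow> j \<le> capped_sum (level j)"
  unfolding level_def by (rule LeastI[of _ "s 0"]) (simp add: capped_sum_all)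

lemma level_le_iff: "j \<le> N \<Longrightarrow> level j \<le> l \<longleftrightarrow> j \<le> capped_sum l"
  using level_le capped_sum_level capped_sum_mono by (meson order_trans)

lemma level_le_self: "j \<le> N \<Longrightarrow> level j \<le> j"
  using level_le capped_sum_ge by blast

text \<open>One more vertex raises the level by at most one, because raising the cap by one makes
  room for it. This monotonicity of the increments is the convexity of
  \<open>max_edges\<close>.\<close>

lemma max_min_degree_Suc:
  assumes "Suc j \<le> N"
  shows "max_min_degree j \<le> max_min_degree (Suc j)"
proof -
  have "j \<le> capped_sum (level j)"
    using assms by (intro capped_sum_level) simp
  then have "Suc j \<le> capped_sum (Suc (level j))"
    using capped_sum_Suc[of "level j"] capped_sum_mono[of "level j" "Suc (level j)"] assms
    by linarith
  then have "level (Suc j) \<le> Suc (level j)" by (rule level_le)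
  then show ?thesis by (simp add: max_min_degree_def)
qed

lemma max_min_degree_mono: "i \<le> j \<Longrightarrow> j \<le> N \<Longrightarrow> max_min_degree i \<le> max_min_degree j"
proof (induction rule: dec_induct)
  case (step n)
  then show ?case using max_min_degree_Suc[of n] by simp
qed simp

lemma max_min_degree_ge: "j \<le> capped_sum l \<Longrightarrow> j - l \<le> max_min_degree j"
  using level_le[of j l] by (simp add: max_min_degree_def)

lemma max_min_degree_le: "j \<le> N \<Longrightarrow> capped_sum l < j \<Longrightarrow> max_min_degree j \<le> j - Suc l"
  using level_le_iff[of j l] by (auto simp: max_min_degree_def)

lemma max_edges_Suc: "max_edges (Suc j) = max_edges j + max_min_degree (Suc j)"
  by (simp add: max_edges_def)

text \<open>If every class of \<open>X\<close> has at most \<open>m\<close> vertices, then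
  \<open>card X \<le> capped_sum m\<close>; so a largest class reaches the level.\<close>

lemma max_class:
  assumes "X \<subseteq> V" "X \<noteq> {}"
  obtains u where "u \<in> X" "level (card X) \<le> class_size X (fst u)"
    "\<And>i. i < k \<Longrightarrow> class_size X i \<le> class_size X (fst u)"
proof -
  have fin: "finite X" using assms finite_V finite_subset by blast
  have "\<exists>i. i < k \<and> (\<forall>j. j < k \<longrightarrow> class_size X j \<le> class_size X i)"
    using ex_has_greatest_nat[of "\<lambda>i. i < k" 0 "class_size X" "Suc (card X)"] two_classes fin
    by (auto simp: class_size_def less_Suc_eq_le intro!: card_mono)
  then obtain i where i: "i < k" "\<And>j. j < k \<Longrightarrow> class_size X j \<le> class_size X i" by blast
  have "(\<Sum>j<k. class_size X j) \<le> (\<Sum>j<k. min (s j) (class_size X i))"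
    using i class_size_le[OF assms(1)] by (intro sum_mono) auto
  then have c: "card X \<le> capped_sum (class_size X i)"
    by (simp add: sum_class_size[OF assms(1)] capped_sum_def)
  then have "class_size X i \<noteq> 0"
    using assms(2) fin capped_sum_0 by (metis card_0_eq le_zero_eq)
  then have "{v \<in> X. fst v = i} \<noteq> {}"
    unfolding class_size_def by (metis card.empty)
  then obtain u where u: "u \<in> X" "fst u = i" by auto
  show thesis
    by (rule that[of u]) (use u i level_le[OF c] in auto)
qed

text \<open>A vertex of a largest class has degree at most \<open>max_min_degree (card X)\<close> by
  \<open>max_class\<close>; delete it and use induction.\<close>

lemma card_induced_le: "X \<subseteq> V \<Longrightarrow> card (induced_edges X) \<le> max_edges (card X)"
proof (induction "card X" arbitrary: X)
  case 0
  then have "X = {}" using finite_V finite_subset by fastforce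
  then show ?case by (simp add: induced_empty)
next
  case (Suc j)
  have fin: "finite X" using Suc finite_V finite_subset by blast
  have "X \<noteq> {}" using Suc.hyps(2) by auto
  from max_class[OF Suc.prems this] obtain u
    where u: "u \<in> X" "level (card X) \<le> class_size X (fst u)" by blast
  have "card (X - {u}) = j" using u Suc.hyps fin by simp
  then have "card (induced_edges (X - {u})) \<le> max_edges j"
    using Suc.hyps(1)[of "X - {u}"] Suc.prems by auto
  moreover have "max_edges (card X) = max_edges j + (card X - level (card X))"
    unfolding Suc.hyps(2)[symmetric] max_edges_Suc max_min_degree_def ..
  moreover have "card X - class_size X (fst u) \<le> card X - level (card X)"
    using u(2) by (rule diff_le_mono2)
  ultimately show ?case
    using card_induced_remove[OF Suc.prems u(1)] by linarith
qed

section \<open>Balanced vertex sets and greedy removal\<close>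

text \<open>The invariant of greedy removal: classes with originally at least \<open>m\<close>
  vertices are cut down to \<open>m\<close> or \<open>m - 1\<close>, smaller ones are intact, and
  \<open>m\<close> is attained.\<close>

definition balanced :: "(nat \<times> nat) set \<Rightarrow> nat \<Rightarrow> bool" where
  "balanced X m \<longleftrightarrow> X \<subseteq> V \<and>
     (\<forall>i<k. class_size X i \<le> m \<and> min (s i) (m - 1) \<le> class_size X i) \<and>
     (\<exists>i<k. class_size X i = m)"

lemma balanced_V: "balanced V (s 0)"
  unfolding balanced_def using two_classes antitone class_size_V by (auto intro!: exI[of _ 0])

lemma balanced_nonempty: "balanced X m \<Longrightarrow> X \<noteq> {} \<Longrightarrow> 1 \<le> m"
proof (rule ccontr)
  assume b: "balanced X m" and "X \<noteq> {}" and m: "\<not> 1 \<le> m"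
  then have X: "X \<subseteq> V" and "\<forall>i<k. class_size X i \<le> m" and "m = 0"
    by (simp_all add: balanced_def)
  then have "(\<Sum>i<k. class_size X i) = 0" by simp
  then have "card X = 0"
    using sum_class_size[OF X] by simp
  then show False
    using \<open>X \<noteq> {}\<close> finite_subset[OF X finite_V] by simp
qed

text \<open>The invariant puts \<open>card X\<close> above \<open>capped_sum (m - 1)\<close>,
  strictly because some class has \<open>m\<close> vertices, and not above
  \<open>capped_sum m\<close>.\<close>

lemma balanced_level:
  assumes "balanced X m" "X \<noteq> {}"
  shows "level (card X) = m"
proof -
  have X: "X \<subseteq> V" and m: "1 \<le> m"
    using assms balanced_nonempty by (auto simp: balanced_def)
  have "(\<Sum>i<k. class_size X i) \<le> (\<Sum>i<k. min (s i) m)"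
    using assms class_size_le[OF X] by (intro sum_mono) (auto simp: balanced_def)
  then have 1: "card X \<le> capped_sum m"
    by (simp add: sum_class_size[OF X] capped_sum_def)
  have "(\<Sum>i<k. min (s i) (m - 1)) < (\<Sum>i<k. class_size X i)"
  proof (rule sum_strict_mono_ex1)
    obtain i where "i < k" "class_size X i = m"
      using assms by (auto simp: balanced_def)
    then show "\<exists>i\<in>{..<k}. min (s i) (m - 1) < class_size X i"
      using m by (intro bexI[of _ i]) auto
  qed (use assms in \<open>auto simp: balanced_def\<close>)
  then have 2: "capped_sum (m - 1) < card X"
    by (simp add: sum_class_size[OF X] capped_sum_def)
  have "card X \<le> N"
    using X finite_V card_mono card_V by metis
  then show ?thesis
    using 1 2 level_le_iff[of "card X" m] level_le_iff[of "card X" "m - 1"] m by linarith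
qed

lemma class_size_remove:
  assumes "X \<subseteq> V" "u \<in> X"
  shows "class_size (X - {u}) i = (if fst u = i then class_size X i - 1 else class_size X i)"
proof -
  have "finite X" using assms finite_V finite_subset by blast
  moreover have "{v \<in> X - {u}. fst v = i} =
      (if fst u = i then {v \<in> X. fst v = i} - {u} else {v \<in> X. fst v = i})"
    by auto
  ultimately show ?thesis using assms by (simp add: class_size_def)
qed

text \<open>The cap stays \<open>m\<close> while another class has \<open>m\<close> vertices, and
  drops to \<open>m - 1\<close> when the last such class is reduced.\<close>

lemma balanced_remove:
  assumes b: "balanced X m" and u: "u \<in> X" "class_size X (fst u) = m"
  shows "\<exists>m'. balanced (X - {u}) m'"
proof -
  have X: "X \<subseteq> V" using b by (simp add: balanced_def)
  have m: "1 \<le> m" using balanced_nonempty[OF b] u by auto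
  have iu: "fst u < k" using X u(1) vertex_class by blast
  note cs = class_size_remove[OF X u(1)]
  show ?thesis
  proof (cases "\<exists>i<k. i \<noteq> fst u \<and> class_size X i = m")
    case True
    then obtain i where i: "i < k" "i \<noteq> fst u" "class_size X i = m" by blast
    have "balanced (X - {u}) m"
      unfolding balanced_def
    proof (intro conjI allI impI)
      show "X - {u} \<subseteq> V" using X by auto
      show "\<exists>i<k. class_size (X - {u}) i = m"
        using i by (intro exI[of _ i]) (simp add: cs)
      fix i assume "i < k"
      then have "class_size X i \<le> m" "min (s i) (m - 1) \<le> class_size X i"
        using b by (auto simp: balanced_def)
      then show "class_size (X - {u}) i \<le> m" "min (s i) (m - 1) \<le> class_size (X - {u}) i"
        using u by (auto simp: cs)
    qed
    then show ?thesis ..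
  next
    case False
    have "balanced (X - {u}) (m - 1)"
      unfolding balanced_def
    proof (intro conjI allI impI)
      show "X - {u} \<subseteq> V" using X by auto
      show "\<exists>i<k. class_size (X - {u}) i = m - 1"
        using iu u by (intro exI[of _ "fst u"]) (simp add: cs)
      fix i assume i: "i < k"
      then have "class_size X i \<le> m" "min (s i) (m - 1) \<le> class_size X i"
        using b by (auto simp: balanced_def)
      moreover have "fst u = i \<or> class_size X i \<noteq> m" using False i by auto
      ultimately show "class_size (X - {u}) i \<le> m - 1"
        "min (s i) (m - 1 - 1) \<le> class_size (X - {u}) i"
        using u by (auto simp: cs)
    qed
    then show ?thesis ..
  qed
qed

text \<open>The case of equality in \<open>card_induced_le\<close>: a largest class of a balanced
  set has exactly \<open>level (card X)\<close> vertices, and removal from it preserves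
  balance.\<close>

lemma balanced_card_induced: "balanced X m \<Longrightarrow> card (induced_edges X) = max_edges (card X)"
proof (induction "card X" arbitrary: X m)
  case 0
  then have "X = {}" using finite_V finite_subset by (fastforce simp: balanced_def)
  then show ?case by (simp add: induced_empty max_edges_def)
next
  case (Suc j)
  have X: "X \<subseteq> V" using Suc.prems by (simp add: balanced_def)
  have ne: "X \<noteq> {}" using Suc.hyps(2) by auto
  have fin: "finite X" using X finite_V finite_subset by blast
  from max_class[OF X ne] obtain u
    where u: "u \<in> X" "\<And>i. i < k \<Longrightarrow> class_size X i \<le> class_size X (fst u)" by blast
  have "class_size X (fst u) = m"
    using Suc.prems u X vertex_class unfolding balanced_def by (meson antisym subsetD)
  moreover have "level (card X) = m" using balanced_level[OF Suc.prems ne] .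
  moreover have c: "j = card (X - {u})" using Suc.hyps(2) u(1) fin by simp
  obtain m' where "balanced (X - {u}) m'"
    using balanced_remove[OF Suc.prems u(1)] calculation(1) by blast
  then have "card (induced_edges (X - {u})) = max_edges j"
    using Suc.hyps(1)[of "X - {u}" m'] c by simp
  moreover have "max_edges (card X) = max_edges j + (card X - level (card X))"
    unfolding Suc.hyps(2)[symmetric] max_edges_Suc max_min_degree_def ..
  ultimately show ?case
    using card_induced_remove[OF X u(1)] by simp
qed

text \<open>A vertex is adjacent to everything outside its class, so minimum degree means a largest
  class, and \<open>balanced_remove\<close> applies whatever the tie-breaking.\<close>

lemma greedy_balanced:
  assumes "balanced X m" "U \<in> greedy_sets r (Graph X (induced_edges X))"
  shows "U \<subseteq> X \<and> card U = r \<and> (\<exists>m'. balanced (X - U) m')"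
  using assms
proof (induction r arbitrary: X m U)
  case 0
  then show ?case by auto
next
  case (Suc r)
  have X: "X \<subseteq> V" using Suc.prems by (simp add: balanced_def)
  have fin: "finite X" using X finite_V finite_subset by blast
  let ?G = "Graph X (induced_edges X)"
  have "\<exists>u U'. U = insert u U' \<and> u \<in> X \<and> (\<forall>v\<in>X. degree ?G u \<le> degree ?G v) \<and>
      U' \<in> greedy_sets r (delete_vertex ?G u)"
    using Suc.prems(2) by simp
  then obtain u U' where u: "u \<in> X" "U = insert u U'"
    and min': "\<And>v. v \<in> X \<Longrightarrow> degree ?G u \<le> degree ?G v"
    and U': "U' \<in> greedy_sets r (Graph (X - {u}) (induced_edges (X - {u})))"
    unfolding delete_vertex_induced by blast
  have min: "card X - class_size X (fst u) \<le> card X - class_size X (fst v)" if "v \<in> X" for v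
    using min'[OF that] degree_induced[OF X] u(1) that by simp
  obtain w where w: "w \<in> X" "\<And>i. i < k \<Longrightarrow> class_size X i \<le> class_size X (fst w)"
    using max_class[OF X] u(1) by blast
  \<comment> \<open>No class exceeds \<open>card X\<close>, so the truncated differences in
    \<open>min\<close> can be inverted.\<close>
  have "class_size X i \<le> card X" for i
    unfolding class_size_def using fin by (intro card_mono) auto
  then have "class_size X (fst w) \<le> class_size X (fst u)"
    using min[OF w(1)] by (metis diff_le_mono2 diff_diff_cancel)
  then have "class_size X (fst u) = m"
    using Suc.prems(1) w(2) u(1) X vertex_class unfolding balanced_def
    by (meson antisym order_trans subsetD)
  then obtain m' where "balanced (X - {u}) m'"
    using balanced_remove[OF Suc.prems(1) u(1)] by blast
  from Suc.IH[OF this U'] have IH: "U' \<subseteq> X - {u}" "card U' = r" "\<exists>m'. balanced (X - {u} - U') m'"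
    by auto
  have "X - U = X - {u} - U'" using u by auto
  moreover have "finite U'" using IH(1) fin finite_subset by blast
  moreover have "u \<notin> U'" using IH(1) by auto
  ultimately show ?case using IH u by auto
qed

lemma induced_V: "induced_edges V = E"
  using edge_subset by (auto simp: induced_edges_def)

lemma card_E: "card E = max_edges N"
  using balanced_card_induced[OF balanced_V] by (simp add: induced_V card_V)

lemma greedy_V:
  assumes "U \<in> greedy_sets r (Graph V E)"
  shows "U \<subseteq> V" "card U = r" "card (induced_edges (V - U)) = max_edges (N - r)"
proof -
  have 1: "U \<subseteq> V \<and> card U = r \<and> (\<exists>m'. balanced (V - U) m')"
    using greedy_balanced[OF balanced_V, of U r] assms by (simp add: induced_V)
  then show 2: "U \<subseteq> V" "card U = r" by auto
  show "card (induced_edges (V - U)) = max_edges (N - r)"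
    using 1 balanced_card_induced finite_V card_V 2
    by (metis card_Diff_subset finite_subset)
qed

lemma card_incident:
  assumes "U \<subseteq> V"
  shows "card (incident_edges (Graph V E) U) + card (induced_edges (V - U)) = card E"
proof -
  have "E = incident_edges (Graph V E) U \<union> induced_edges (V - U)"
    "incident_edges (Graph V E) U \<inter> induced_edges (V - U) = {}"
    using edge_subset by (auto simp: incident_edges_def induced_edges_def)
  then show ?thesis
    using finite_E by (metis card_Un_disjoint finite_Un)
qed

text \<open>Each edge is counted at its endpoint in the class of larger index.\<close>

lemma card_E_sum: "card E = (\<Sum>j<k. \<Sum>i<j. s i * s j)"
proof -
  let ?Q = "Sigma V (\<lambda>v. {u \<in> V. fst u < fst v})"
  have "E = (\<lambda>(v, u). {u, v}) ` ?Q"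
  proof
    show "E \<subseteq> (\<lambda>(v, u). {u, v}) ` ?Q"
    proof
      fix e assume "e \<in> E"
      then obtain u v where e: "e = {u, v}" "u \<in> V" "v \<in> V" "fst u \<noteq> fst v" by (rule edgeE)
      then consider "fst u < fst v" | "fst v < fst u" by linarith
      then show "e \<in> (\<lambda>(v, u). {u, v}) ` ?Q"
      proof cases
        case 1
        then show ?thesis using e by (intro image_eqI[of _ _ "(v, u)"]) simp_all
      next
        case 2
        then show ?thesis using e by (intro image_eqI[of _ _ "(u, v)"]) (simp_all add: insert_commute)
      qed
    qed
  qed (auto simp: edge_iff)
  moreover have "inj_on (\<lambda>(v, u). {u, v}) ?Q"
    by (auto simp: inj_on_def doubleton_eq_iff)
  ultimately have "card E = card ?Q" by (simp add: card_image)
  also have "\<dots> = (\<Sum>v\<in>V. card {u \<in> V. fst u < fst v})"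
    using finite_V by (intro card_SigmaI) auto
  also have "\<dots> = (\<Sum>v\<in>V. \<Sum>i<fst v. s i)"
  proof (rule sum.cong)
    fix v assume "v \<in> V"
    then have "{u \<in> V. fst u < fst v} = Sigma {..<fst v} (\<lambda>i. {..<s i})"
      by (auto simp: V_def)
    then show "card {u \<in> V. fst u < fst v} = (\<Sum>i<fst v. s i)" by simp
  qed simp
  also have "\<dots> = (\<Sum>j<k. \<Sum>a<s j. \<Sum>i<j. s i)"
    unfolding V_def by (subst sum.Sigma) (auto intro!: sum.cong)
  also have "\<dots> = (\<Sum>j<k. \<Sum>i<j. s i * s j)"
    by (simp add: sum_distrib_left mult.commute)
  finally show ?thesis .
qed

lemma linked_V: "linked E V"
proof (rule linkedI)
  have 01: "(0, 0) \<in> V" "(1, 0) \<in> V"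
    using two_classes pos[of 0] pos[of 1] by (auto simp: V_iff)
  then show "V \<noteq> {}" by auto
  fix Y assume Y: "Y \<subseteq> V" "Y \<noteq> {}" "Y \<noteq> V"
  then obtain y z where yz: "y \<in> Y" "z \<in> V - Y" by blast
  obtain w where w: "w \<in> V" "fst w \<noteq> fst y"
    using 01 by (metis fst_conv zero_neq_one)
  show "\<exists>u\<in>Y. \<exists>v\<in>V - Y. {u, v} \<in> E"
  proof (cases "fst y = fst z")
    case False
    then show ?thesis using yz Y edge_iff by blast
  next
    case True
    then have "{y, w} \<in> E" "{w, z} \<in> E"
      using yz w Y by (auto simp: edge_iff)
    then show ?thesis using yz w by (cases "w \<in> Y") blast+
  qed
qed

lemma linked_edge:
  assumes "linked R D" "2 \<le> card D"
  obtains u v where "u \<in> D" "v \<in> D" "u \<noteq> v" "{u, v} \<in> R"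
proof -
  obtain x where x: "x \<in> D" using linked_nonempty[OF assms(1)] by auto
  have "D \<noteq> {x}" using assms(2) by auto
  then show thesis
    using linkedD[OF assms(1), of "{x}"] x that by blast
qed

text \<open>\<open>D\<close> contains an edge, and at most one of its ends shares the class of
  \<open>w\<close>.\<close>

lemma linked_adjacent:
  assumes "w \<in> V" "linked E D" "2 \<le> card D"
  shows "\<exists>v\<in>D. {w, v} \<in> E"
proof -
  obtain u v where "u \<in> D" "v \<in> D" "{u, v} \<in> E"
    using linked_edge[OF assms(2,3)] by blast
  then show ?thesis using assms(1) by (metis edge_iff)
qed

end

section \<open>The number of edges of a separated subgraph\<close>

definition edges_within :: "'a set set \<Rightarrow> 'a set \<Rightarrow> 'a set set" where
  "edges_within R U = {e \<in> R. e \<subseteq> U}"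

text \<open>No edge of \<open>R\<close> leaves \<open>U\<close>, so \<open>U\<close> is a union of
  components; this avoids handling the set of all components.\<close>

definition closed_in :: "'a set set \<Rightarrow> 'a set \<Rightarrow> bool" where
  "closed_in R U \<longleftrightarrow> (\<forall>e\<in>R. e \<subseteq> U \<or> e \<inter> U = {})"

lemma card_edges_within_split:
  assumes "finite R" "{} \<notin> R" "closed_in R X" "X \<subseteq> U"
  shows "card (edges_within R U) = card (edges_within R X) + card (edges_within R (U - X))"
proof -
  have "edges_within R U = edges_within R X \<union> edges_within R (U - X)"
    using assms(3,4) unfolding edges_within_def closed_in_def by fast
  moreover have "edges_within R X \<inter> edges_within R (U - X) = {}"
  proof -
    have "e = {}" if "e \<subseteq> X" "e \<subseteq> U - X" for e
      using that by blast
    then show ?thesis using assms(2) unfolding edges_within_def by blast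
  qed
  moreover have "finite (edges_within R X)" "finite (edges_within R (U - X))"
    using assms(1) by (auto simp: edges_within_def)
  ultimately show ?thesis by (metis card_Un_disjoint)
qed

context multipartite
begin

section \<open>Convexity and small values of \<open>max_edges\<close>\<close>

lemma N_ge_k: "k \<le> N"
  using capped_sum_1 capped_sum_all[of "max 1 (s 0)"] capped_sum_mono[of 1 "max 1 (s 0)"] by simp

lemma max_min_degree_1: "max_min_degree 1 = 0"
proof -
  have "1 \<le> N" using N_ge_k two_classes by simp
  then show ?thesis using max_min_degree_le[of 1 0] by (simp add: capped_sum_0)
qed

lemma max_min_degree_2: "max_min_degree 2 = 1"
  using max_min_degree_le[of 2 0] max_min_degree_ge[of 2 1] N_ge_k two_classes
  by (simp add: capped_sum_0 capped_sum_1[unfolded One_nat_def])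

lemma max_edges_1: "max_edges 1 = 0"
  using max_min_degree_1 by (simp add: max_edges_def)

lemma max_edges_2: "max_edges 2 = 1"
  using max_edges_Suc[of 1] max_edges_1 max_min_degree_2 by (simp add: numeral_2_eq_2)

lemma max_edges_3: "max_edges 3 = 1 + max_min_degree 3"
  using max_edges_Suc[of 2] max_edges_2 by (simp add: numeral_3_eq_3 numeral_2_eq_2)

text \<open>This and \<open>max_edges_add_ge\<close> are the two halves of the convexity argument:
  on at most \<open>c\<close> vertices a vertex is worth at most \<open>max_min_degree c\<close>
  edges, beyond \<open>c\<close> vertices at least that many.\<close>

lemma max_edges_add_le:
  "b + t \<le> c \<Longrightarrow> c \<le> N \<Longrightarrow> max_edges (b + t) \<le> max_edges b + t * max_min_degree c"
proof (induction t)
  case (Suc t)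
  then have "max_min_degree (Suc (b + t)) \<le> max_min_degree c"
    by (intro max_min_degree_mono) auto
  then show ?case using Suc by (simp add: max_edges_Suc)
qed simp

lemma max_edges_add_ge:
  "c \<le> a \<Longrightarrow> a + t \<le> N \<Longrightarrow> max_edges a + t * max_min_degree c \<le> max_edges (a + t)"
proof (induction t)
  case (Suc t)
  then have "max_min_degree c \<le> max_min_degree (Suc (a + t))"
    by (intro max_min_degree_mono) auto
  then show ?case using Suc by (simp add: max_edges_Suc)
qed simp

text \<open>Here and in the next two lemmas the reduction stops at 1, 2 or 3 vertices. Stopping
  earlier saves increments at the price of the edges on the remaining vertices.\<close>

lemma max_edges_le1: "1 \<le> b \<Longrightarrow> b \<le> c \<Longrightarrow> c \<le> N \<Longrightarrow> max_edges b \<le> (b - 1) * max_min_degree c"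
  using max_edges_add_le[of 1 "b - 1" c] by (simp add: max_edges_1[unfolded One_nat_def])

lemma max_edges_le2: "2 \<le> b \<Longrightarrow> b \<le> c \<Longrightarrow> c \<le> N \<Longrightarrow> max_edges b \<le> 1 + (b - 2) * max_min_degree c"
  using max_edges_add_le[of 2 "b - 2" c] by (simp only: le_add_diff_inverse max_edges_2)

lemma max_edges_le3: "3 \<le> b \<Longrightarrow> b \<le> c \<Longrightarrow> c \<le> N \<Longrightarrow>
    max_edges b \<le> 1 + max_min_degree 3 + (b - 3) * max_min_degree c"
  using max_edges_add_le[of 3 "b - 3" c] by (simp only: le_add_diff_inverse max_edges_3)

lemma capped_sum_three:
  "3 \<le> k \<Longrightarrow> min (s 0) l + min (s 1) l + min (s 2) l \<le> capped_sum l"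
proof -
  assume "3 \<le> k"
  then have "(\<Sum>i\<in>{0, 1, 2}. min (s i) l) \<le> capped_sum l"
    unfolding capped_sum_def by (intro sum_mono2) auto
  then show ?thesis by simp
qed

text \<open>It suffices to place \<open>q - 1\<close> vertices with at most \<open>q - 3\<close> in
  each class. For \<open>k = 2\<close> and \<open>q = 4\<close> this is impossible, as three
  vertices in two classes put two into one; here \<open>K_{3,3}\<close> and \<open>K_{4,3}\<close>
  originate.\<close>

lemma max_min_degree_ge_2:
  assumes "4 \<le> q" "q < N" "3 + s 0 \<le> N" "\<not> (k = 2 \<and> q = 4)"
  shows "2 \<le> max_min_degree (q - 1)"
proof -
  have "q - 1 \<le> capped_sum (q - 3)"
  proof (cases "s 0 \<le> q - 3")
    case True
    then show ?thesis using capped_sum_all assms by simp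
  next
    case big: False
    show ?thesis
    proof (cases "k = 2")
      case True
      then have "N = s 0 + s 1" "capped_sum (q - 3) = min (s 0) (q - 3) + min (s 1) (q - 3)"
        unfolding N_def capped_sum_def by (simp_all add: numeral_2_eq_2)
      then show ?thesis using assms big True by linarith
    next
      case False
      then have "3 \<le> k" using two_classes by simp
      then show ?thesis
        using capped_sum_three[of "q - 3"] pos[of 1] pos[of 2] assms(1) big by linarith
    qed
  qed
  then show ?thesis
    using max_min_degree_ge[of "q - 1" "q - 3"] assms(1) by linarith
qed

lemma max_min_degree_3_le: "3 \<le> N \<Longrightarrow> max_min_degree 3 \<le> 2"
  using max_min_degree_le[of 3 0] by (simp add: capped_sum_0)

text \<open>Three vertices outside class 0 force \<open>s 1 \<ge> 2\<close>, so
  \<open>K_{2,2,1}\<close> is contained in the graph.\<close>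

lemma max_min_degree_3_classes:
  assumes "k = 3" "s 0 + 3 \<le> N"
  shows "max_min_degree 3 = 2" "2 \<le> max_min_degree 4" "3 \<le> max_min_degree 5"
proof -
  have N: "N = s 0 + s 1 + s 2" unfolding N_def unfolding assms(1) by (simp add: numeral_3_eq_3 numeral_2_eq_2)
  have p: "1 \<le> s 2" "s 2 \<le> s 1" "s 1 \<le> s 0" using assms(1) pos[of 2] antitone[of 1 2] antitone[of 0 1] by auto
  have "5 \<le> capped_sum 2"
    using capped_sum_three[of 2] p N assms by linarith
  then show "2 \<le> max_min_degree 4" "3 \<le> max_min_degree 5"
    using max_min_degree_ge[of 4 2] max_min_degree_ge[of 5 2] by linarith+
  show "max_min_degree 3 = 2"
    using max_min_degree_ge[of 3 1] max_min_degree_3_le capped_sum_1 assms by simp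
qed

text \<open>The left side is \<open>2 * max_edges 3\<close>, the right side the last two increments
  of \<open>max_edges (q - 1)\<close>. The increments come from \<open>K_{2,2}\<close>,
  \<open>K_{2,2,1}\<close> and \<open>K_4\<close> for \<open>k = 2\<close>, \<open>k = 3\<close> and
  \<open>k \<ge> 4\<close>. For \<open>k = 3\<close> and \<open>q = 6\<close> the left side is 6,
  but the right side is at most 2 + 3.\<close>

lemma max_min_degree_pair:
  assumes "6 \<le> q" "q < N" "3 + s 0 \<le> N" "\<not> (k = 3 \<and> q = 6)"
  shows "2 + 2 * max_min_degree 3 \<le> max_min_degree (q - 2) + max_min_degree (q - 1)"
proof -
  have mono: "max_min_degree j \<le> max_min_degree (q - 2)" "max_min_degree j \<le> max_min_degree (q - 1)"
    if "j \<le> q - 2" for j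
    using that assms by (auto intro!: max_min_degree_mono)
  consider "k = 2" | "k = 3" | "4 \<le> k" using two_classes by linarith
  then show ?thesis
  proof cases
    case 1
    then have N: "N = s 0 + s 1" "capped_sum 2 = min (s 0) 2 + min (s 1) 2"
      unfolding N_def capped_sum_def by (simp_all add: numeral_2_eq_2)
    moreover have "s 1 \<le> s 0" using antitone[of 0 1] 1 by simp
    ultimately have "2 \<le> max_min_degree 4"
      using assms max_min_degree_ge[of 4 2] by linarith
    moreover have "max_min_degree 3 \<le> 1"
      using max_min_degree_le[of 3 1] capped_sum_1 1 assms by simp
    ultimately show ?thesis using mono[of 4] assms(1) by linarith
  next
    case 2
    have "s 0 + 3 \<le> N" "7 \<le> q" using assms 2 by auto
    then show ?thesis
      using mono(1)[of 5] mono(2)[of 5] max_min_degree_3_classes[OF 2] by linarith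
  next
    case 3
    then have "3 \<le> max_min_degree 4"
      using max_min_degree_ge[of 4 1] capped_sum_1 by simp
    moreover have "max_min_degree 3 \<le> 2"
      using max_min_degree_3_le assms by simp
    ultimately show ?thesis
      using mono(1)[of 4] mono(2)[of 4] assms(1) by linarith
  qed
qed

section \<open>Components of a separated subgraph and their edges\<close>

lemma card_edges_within_le:
  assumes "R \<subseteq> E" "X \<subseteq> V"
  shows "card (edges_within R X) \<le> max_edges (card X)"
proof -
  have "card (edges_within R X) \<le> card (induced_edges X)"
    using assms(1) finite_induced by (intro card_mono) (auto simp: edges_within_def induced_edges_def)
  then show ?thesis using card_induced_le[OF assms(2)] by simp
qed

text \<open>A largest linked subset of a closed set is a component, since an edge leaving it would
  enlarge it.\<close>

lemma largest_linked:
  assumes "R \<subseteq> E" "U \<subseteq> V" "U \<noteq> {}" "closed_in R U"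
  obtains X where "X \<subseteq> U" "linked R X" "closed_in R X" "closed_in R (U - X)"
    "\<And>Y. Y \<subseteq> U \<Longrightarrow> linked R Y \<Longrightarrow> card Y \<le> card X"
proof -
  have finU: "finite U" using assms(2) finite_V finite_subset by blast
  obtain x0 where "x0 \<in> U" using assms(3) by auto
  then have x: "{x0} \<subseteq> U \<and> linked R {x0}" using linked_singleton[of R x0] by simp
  have "\<forall>Y. Y \<subseteq> U \<and> linked R Y \<longrightarrow> card Y < Suc (card U)"
    using finU by (auto simp: less_Suc_eq_le intro: card_mono)
  from ex_has_greatest_nat[where P = "\<lambda>Y. Y \<subseteq> U \<and> linked R Y", OF x this]
  obtain X where X: "X \<subseteq> U" "linked R X" and max: "\<forall>Y. Y \<subseteq> U \<and> linked R Y \<longrightarrow> card Y \<le> card X"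
    by metis
  have finX: "finite X" using X(1) finU finite_subset by blast
  have step: "v \<in> X" if "u \<in> X" "{u, v} \<in> R" for u v
  proof (rule ccontr)
    assume v: "v \<notin> X"
    have "{u, v} \<subseteq> U \<or> {u, v} \<inter> U = {}"
      using assms(4) that(2) unfolding closed_in_def by (rule bspec)
    moreover have "u \<in> U" using that(1) X(1) by (rule rev_subsetD)
    ultimately have "insert v X \<subseteq> U" using X(1) by simp
    then have "card (insert v X) \<le> card X"
      using linked_insert_edge[OF X(2) that] max by simp
    then show False using v finX by simp
  qed
  have cX: "closed_in R X"
    unfolding closed_in_def
  proof
    fix e assume e: "e \<in> R"
    then obtain u v where "e = {u, v}" using assms(1) by (meson edgeE subsetD)
    then show "e \<subseteq> X \<or> e \<inter> X = {}"
      using step[of u v] step[of v u] e by (auto simp: insert_commute)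
  qed
  moreover have "closed_in R (U - X)"
    using cX assms(4) unfolding closed_in_def by blast
  ultimately show thesis using that[of X] X max by blast
qed

text \<open>By \<open>max_edges_le1\<close> every component saves one vertex. The bound keeps only
  one of these savings; where more are needed, it is applied to several closed sets
  separately.\<close>

lemma edges_within_forest_bound:
  assumes R: "R \<subseteq> E"
  shows "U \<subseteq> V \<Longrightarrow> U \<noteq> {} \<Longrightarrow> closed_in R U \<Longrightarrow> c \<le> N \<Longrightarrow>
    (\<And>Y. Y \<subseteq> U \<Longrightarrow> linked R Y \<Longrightarrow> card Y \<le> c) \<Longrightarrow>
    card (edges_within R U) \<le> (card U - 1) * max_min_degree c"
proof (induction "card U" arbitrary: U rule: less_induct)
  case less
  have finU: "finite U" using less.prems(1) finite_V finite_subset by blast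
  have finR: "finite R" and neR: "{} \<notin> R"
    using R finite_E finite_subset edge_subset by (blast, fastforce)
  obtain X where X: "X \<subseteq> U" "linked R X" "closed_in R X" "closed_in R (U - X)"
    using largest_linked[OF R less.prems(1-3)] by metis
  have XV: "X \<subseteq> V" using X less.prems by blast
  have pX: "0 < card X"
    using linked_nonempty[OF X(2)] X(1) finU by (auto simp: card_gt_0_iff intro: finite_subset)
  have b: "card (edges_within R X) \<le> (card X - 1) * max_min_degree c"
    using card_edges_within_le[OF R XV] max_edges_le1[of "card X" c] pX less.prems(4) less.prems(5)[OF X(1,2)]
    by linarith
  have split: "card (edges_within R U) = card (edges_within R X) + card (edges_within R (U - X))"
    by (rule card_edges_within_split[OF finR neR X(3,1)])
  have cU: "card (U - X) = card U - card X" "card X \<le> card U"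
    using X(1) finU by (auto simp: card_Diff_subset finite_subset card_mono)
  show ?case
  proof (cases "U - X = {}")
    case True
    then have "U = X" using X(1) by auto
    then show ?thesis using b by simp
  next
    case False
    then have p: "0 < card (U - X)" using finU by (simp add: card_gt_0_iff)
    have "card (edges_within R (U - X)) \<le> (card (U - X) - 1) * max_min_degree c"
    proof (rule less.hyps)
      show "card (U - X) < card U" using cU pX p by linarith
      show "card Y \<le> c" if "Y \<subseteq> U - X" "linked R Y" for Y
        using less.prems(5)[of Y] that by auto
    qed (use less.prems X False in auto)
    then have "card (edges_within R U) \<le> (card X - 1 + (card (U - X) - 1)) * max_min_degree c"
      using split b by (simp add: add_mult_distrib)
    also have "\<dots> \<le> (card U - 1) * max_min_degree c"
      using cU pX p by (intro mult_right_mono) auto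
    finally show ?thesis .
  qed
qed

lemma linked_leaves_class_0:
  assumes "R \<subseteq> E" "linked R X" "2 \<le> card X"
  shows "\<exists>v\<in>X. fst v \<noteq> 0"
proof -
  obtain u v where uv: "u \<in> X" "v \<in> X" "{u, v} \<in> R"
    using linked_edge[OF assms(2,3)] by metis
  then have "fst u \<noteq> fst v" using assms(1) edge_iff by blast
  then show ?thesis using uv by (metis)
qed

text \<open>Each of the three sets contains an edge and hence a vertex outside class 0.\<close>

lemma three_disjoint_linked:
  assumes R: "R \<subseteq> E" and V: "X \<subseteq> V" "Y \<subseteq> V" "Z \<subseteq> V"
    and disj: "X \<inter> Y = {}" "X \<inter> Z = {}" "Y \<inter> Z = {}"
    and linked: "linked R X" "linked R Y" "linked R Z"
    and card: "2 \<le> card X" "2 \<le> card Y" "2 \<le> card Z"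
  shows "3 + s 0 \<le> N"
proof -
  obtain x y z where xyz: "x \<in> X" "y \<in> Y" "z \<in> Z" "fst x \<noteq> 0" "fst y \<noteq> 0" "fst z \<noteq> 0"
    using linked_leaves_class_0[OF R] linked card by metis
  then have "x \<noteq> y" "x \<noteq> z" "y \<noteq> z" using disj by blast+
  then have "card {x, y, z} = 3" by simp
  moreover have "{x, y, z} \<subseteq> V - {v \<in> V. fst v = 0}" using xyz V by auto
  then have "card {x, y, z} \<le> card (V - {v \<in> V. fst v = 0})"
    using finite_V by (intro card_mono) auto
  moreover have "card (V - {v \<in> V. fst v = 0}) = N - s 0"
    using class_size_V[of 0] two_classes finite_V
    by (subst card_Diff_subset) (auto simp: class_size_def card_V)
  ultimately show ?thesis by linarith
qed

text \<open>Two of the three vertices share a class, so they span no triangle.\<close>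

lemma edges_within_three_missing_class:
  assumes R: "R \<subseteq> E" and X: "X \<subseteq> V" "card X = 3" and k: "k = 3" and miss: "class_size X 2 = 0"
  shows "card (edges_within R X) \<le> 2"
proof -
  have fin: "finite X" using X(1) finite_V finite_subset by blast
  have "class_size X 0 + class_size X 1 = 3"
    using sum_class_size[OF X(1)] k miss X(2) by (simp add: numeral_3_eq_3 numeral_2_eq_2)
  moreover obtain u where u: "u \<in> X" "\<And>i. i < k \<Longrightarrow> class_size X i \<le> class_size X (fst u)"
    using max_class[OF X(1)] X(2) by (metis card.empty zero_neq_numeral)
  ultimately have "2 \<le> class_size X (fst u)"
    using u(2)[of 0] u(2)[of 1] k by linarith
  moreover have "card (induced_edges (X - {u})) \<le> 1"
    using card_induced_le[of "X - {u}"] X u(1) fin max_edges_2 by auto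
  ultimately have "card (induced_edges X) \<le> 2"
    using card_induced_remove[OF X(1) u(1)] X(2) by linarith
  moreover have "card (edges_within R X) \<le> card (induced_edges X)"
    using R finite_induced by (intro card_mono) (auto simp: edges_within_def induced_edges_def)
  ultimately show ?thesis by linarith
qed

definition exceptional :: "nat \<Rightarrow> bool" where
  "exceptional q \<longleftrightarrow> (k = 2 \<and> q = 4 \<and> (s 0 = 3 \<or> s 0 = 4) \<and> s 1 = 3) \<or>
     (k = 3 \<and> q = 6 \<and> s 0 = 3 \<and> s 1 = 3 \<and> s 2 = 3)"

text \<open>The three largest components have sizes \<open>a \<ge> c \<ge> b\<close>, and
  \<open>t = q - a - c\<close> is the slack. Edges outside the first are paid for at the rate
  \<open>d = max_min_degree c\<close>, since \<open>max_edges\<close> grows at least that fast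
  beyond \<open>a\<close>. The \<open>N - q + t\<close> vertices of \<open>V2\<close> may cost
  \<open>t * d\<close>, so the number of components in \<open>V2\<close> decides.\<close>

lemma separated_edges_bound:
  assumes R: "R \<subseteq> E" "\<not> linked R V"
    and pair: "\<And>X Y. X \<subseteq> V \<Longrightarrow> Y \<subseteq> V \<Longrightarrow> X \<inter> Y = {} \<Longrightarrow> linked R X \<Longrightarrow> linked R Y \<Longrightarrow>
      card X + card Y \<le> q"
    and q: "2 \<le> q" "N \<le> q + 3" "q < N"
  shows "card R \<le> max_edges (q - 1) \<or> exceptional q \<and> card R \<le> Suc (max_edges (q - 1))"
proof -
  have finR: "finite R" and neR: "{} \<notin> R"
    using R(1) finite_E finite_subset edge_subset by (blast, fastforce)
  note split = card_edges_within_split[OF finR neR]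
  have V0: "V \<noteq> {}" using linked_nonempty[OF linked_V] .
  have "closed_in R V" using R(1) edge_subset by (auto simp: closed_in_def)
  then obtain X1 where X1: "X1 \<subseteq> V" "linked R X1" "closed_in R X1" "closed_in R (V - X1)"
    and max1: "\<And>Y. Y \<subseteq> V \<Longrightarrow> linked R Y \<Longrightarrow> card Y \<le> card X1"
    using largest_linked[OF R(1) order_refl V0] by metis
  define V1 where "V1 = V - X1"
  have V1: "V1 \<subseteq> V" "V1 \<noteq> {}" "closed_in R V1"
    using X1 R(2) by (auto simp: V1_def)
  obtain X2 where X2: "X2 \<subseteq> V1" "linked R X2" "closed_in R X2" "closed_in R (V1 - X2)"
    and max2: "\<And>Y. Y \<subseteq> V1 \<Longrightarrow> linked R Y \<Longrightarrow> card Y \<le> card X2"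
    using largest_linked[OF R(1) V1] by metis
  define V2 where "V2 = V1 - X2"
  have V2: "V2 \<subseteq> V" "closed_in R V2" using X2 V1 by (auto simp: V2_def)
  have fin: "finite X" if "X \<subseteq> V" for X using that finite_V finite_subset by blast
  have X2V: "X2 \<subseteq> V" using X2 V1 by auto
  define a c where "a = card X1" and "c = card X2"
  have ac: "c \<le> a" using max1[OF X2V X2(2)] by (simp add: a_def c_def)
  have c1: "1 \<le> c"
    using linked_nonempty[OF X2(2)] fin[OF X2V] by (simp add: c_def Suc_le_eq card_gt_0_iff)
  have acq: "a + c \<le> q"
    unfolding a_def c_def using X1 X2 X2V by (intro pair) (auto simp: V1_def)
  have cV2: "card V2 = N - a - c"
    unfolding V2_def V1_def a_def c_def
    using X1(1) X2V X2(1) fin by (simp add: card_Diff_subset card_V V1_def)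
  then have V2_ne: "V2 \<noteq> {}" using acq q by auto
  define t where "t = q - a - c"
  have t: "q = a + c + t" using acq by (simp add: t_def)
  define d where "d = max_min_degree c"
  have cN: "c \<le> N" "a \<le> N" using acq q by auto
  have total: "card R = card (edges_within R X1) + card (edges_within R X2) + card (edges_within R V2)"
  proof -
    have "edges_within R V = R" using R(1) edge_subset by (auto simp: edges_within_def)
    then show ?thesis
      using split[OF X1(3,1)] split[OF X2(3,1)] by (simp add: V1_def V2_def)
  qed
  have e1: "card (edges_within R X1) \<le> max_edges a"
    unfolding a_def by (rule card_edges_within_le[OF R(1) X1(1)])
  have e2: "card (edges_within R X2) \<le> max_edges c"
    unfolding c_def by (rule card_edges_within_le[OF R(1) X2V])
  \<comment> \<open>The budget: \<open>c - 1\<close> vertices of the second component and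
    \<open>t\<close> more enlarge the first one to exactly \<open>q - 1\<close>.\<close>
  have enough: ?thesis if "card (edges_within R V2) \<le> t * d"
  proof -
    have "card R \<le> max_edges a + (c - 1) * d + t * d"
      using total e1 e2 that max_edges_le1[OF c1 order_refl cN(1)] by (simp add: d_def)
    also have "\<dots> = max_edges a + (c - 1 + t) * d" by (simp add: add_mult_distrib)
    also have "\<dots> \<le> max_edges (a + (c - 1 + t))"
      unfolding d_def using ac t q c1 by (intro max_edges_add_ge) auto
    also have "a + (c - 1 + t) = q - 1" using t c1 by simp
    finally show ?thesis by simp
  qed
  have small: "card (edges_within R U) \<le> (card U - 1) * d"
    if "U \<subseteq> V2" "U \<noteq> {}" "closed_in R U" for U
    unfolding d_def
  proof (rule edges_within_forest_bound[OF R(1) _ that(2,3) cN(1)])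
    show "U \<subseteq> V" using that(1) V2(1) by blast
    show "card Y \<le> c" if "Y \<subseteq> U" "linked R Y" for Y
      unfolding c_def using that \<open>U \<subseteq> V2\<close> by (intro max2) (auto simp: V2_def)
  qed
  obtain X3 where X3: "X3 \<subseteq> V2" "linked R X3" "closed_in R X3" "closed_in R (V2 - X3)"
    and max3: "\<And>Y. Y \<subseteq> V2 \<Longrightarrow> linked R Y \<Longrightarrow> card Y \<le> card X3"
    using largest_linked[OF R(1) V2(1) V2_ne V2(2)] by metis
  have X3V: "X3 \<subseteq> V" using X3 V2 by auto
  define b where "b = card X3"
  have bc: "b \<le> c" using max2[of X3] X3 by (auto simp: b_def c_def V2_def)
  have b1: "1 \<le> b"
    using linked_nonempty[OF X3(2)] fin[OF X3V] by (simp add: b_def Suc_le_eq card_gt_0_iff)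
  have e3: "card (edges_within R X3) \<le> max_edges b"
    unfolding b_def by (rule card_edges_within_le[OF R(1) X3V])
  define V3 where "V3 = V2 - X3"
  have V3: "V3 \<subseteq> V" "closed_in R V3" using X3 V2 by (auto simp: V3_def)
  have cV3: "card V3 = N - a - c - b" "b \<le> N - a - c"
    unfolding V3_def b_def cV2[symmetric] using X3(1) fin[OF V2(1)] fin[OF X3V]
    by (auto simp: card_Diff_subset card_mono)
  have total3: "card (edges_within R V2) = card (edges_within R X3) + card (edges_within R V3)"
    unfolding V3_def by (rule split[OF X3(3,1)])
  have wide: "3 + s 0 \<le> N" if "2 \<le> b"
  proof (rule three_disjoint_linked[OF R(1) X1(1) X2V X3V])
    show "X1 \<inter> X2 = {}" "X1 \<inter> X3 = {}" "X2 \<inter> X3 = {}"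
      using X2 X3 by (auto simp: V1_def V2_def)
  qed (use X1 X2 X3 that ac bc in \<open>auto simp: a_def b_def c_def\<close>)
  \<comment> \<open>Reducing the second component to an edge and allowing one extra edge in
    \<open>V2\<close> gives a surplus of 2 over \<open>max_edges (q - 2)\<close>, absorbed by the
    last increment \<open>max_min_degree (q - 1)\<close> if that is at least 2.\<close>
  have one_extra: ?thesis
    if b2: "2 \<le> b" and nq: "N \<noteq> q + 1" and extra: "card (edges_within R V2) \<le> 1 + t * d"
  proof -
    have "card R \<le> max_edges a + (c - 2 + t) * d + 2"
    proof -
      have "max_edges c \<le> 1 + (c - 2) * d"
        unfolding d_def using b2 bc cN by (intro max_edges_le2) auto
      then show ?thesis
        unfolding add_mult_distrib using total e1 e2 extra by linarith
    qed
    also have "max_edges a + (c - 2 + t) * d \<le> max_edges (a + (c - 2 + t))"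
      unfolding d_def using ac t q c1 by (intro max_edges_add_ge) auto
    also have "a + (c - 2 + t) = q - 2" using t b2 bc by linarith
    finally have "card R \<le> max_edges (q - 2) + 2" by simp
    moreover have "max_edges (q - 1) = max_edges (q - 2) + max_min_degree (q - 1)"
    proof -
      have "Suc (q - 2) = q - 1" using t b2 bc ac by linarith
      then show ?thesis using max_edges_Suc[of "q - 2"] by simp
    qed
    ultimately have R': "card R + max_min_degree (q - 1) \<le> max_edges (q - 1) + 2" by simp
    have q4: "4 \<le> q" using t ac bc b2 by linarith
    show ?thesis
    proof (cases "k = 2 \<and> q = 4")
      case False
      then show ?thesis using max_min_degree_ge_2[OF q4 q(3) wide[OF b2]] R' by simp
    next
      \<comment> \<open>Now \<open>s 1 \<ge> 3\<close> and \<open>N \<le> 7\<close> leave only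
        \<open>K_{3,3}\<close> and \<open>K_{4,3}\<close>; the increment is still at least
        1.\<close>
      case True
      then have "N = s 0 + s 1" "s 1 \<le> s 0"
        using antitone[of 0 1] unfolding N_def by (auto simp: numeral_2_eq_2)
      then have "exceptional q"
        unfolding exceptional_def using True wide[OF b2] q by auto
      moreover have "max_min_degree 2 \<le> max_min_degree (q - 1)"
        using q4 q by (intro max_min_degree_mono) auto
      ultimately show ?thesis using R' max_min_degree_2 by simp
    qed
  qed
  consider (one) "N = q + 1" | (two) "N = q + 2" | (three) "N = q + 3" using q by linarith
  then show ?thesis
  proof cases
    case one
    have "card (edges_within R V2) \<le> t * d"
      using small[OF order_refl V2_ne V2(2)] cV2 one t by simp
    then show ?thesis by (rule enough)
  next
    \<comment> \<open>\<open>V2\<close> has \<open>t + 2\<close> vertices: two components save two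
      of them, while a single one is reduced to an edge, the extra edge.\<close>
    case two
    show ?thesis
    proof (cases "V3 = {}")
      case True
      then have bt: "b = 2 + t" using cV3 two t by simp
      have "V2 = X3" using X3(1) True by (auto simp: V3_def)
      moreover have "max_edges b \<le> 1 + t * d"
        using max_edges_le2[of b c] bt bc cN by (simp add: d_def)
      ultimately have "card (edges_within R V2) \<le> 1 + t * d"
        using e3 by simp
      then show ?thesis using one_extra bt two by simp
    next
      case False
      have "card (edges_within R V2) \<le> (b - 1) * d + (card V3 - 1) * d"
        using total3 small[of X3] small[of V3] X3 V3 False linked_nonempty[OF X3(2)]
        by (fastforce simp: b_def V3_def)
      also have "\<dots> = (b - 1 + (card V3 - 1)) * d" by (simp add: add_mult_distrib)
      also have "b - 1 + (card V3 - 1) = t"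
        using False fin[OF V3(1)] cV3 two t b1 card_gt_0_iff[of V3] by linarith
      finally show ?thesis by (rule enough)
    qed
  next
    \<comment> \<open>\<open>V2\<close> has \<open>t + 3\<close> vertices: three components fit the
      budget, two lead to \<open>one_extra\<close>, and for a single one both it and the second
      component are reduced to three vertices.\<close>
    case three
    show ?thesis
    proof (cases "V3 = {}")
      case True
      then have bt: "b = 3 + t" using cV3 three t by simp
      have e2': "max_edges c \<le> 1 + max_min_degree 3 + (c - 3) * d"
        unfolding d_def using bt bc cN by (intro max_edges_le3) auto
      have e3': "max_edges b \<le> 1 + max_min_degree 3 + t * d"
        unfolding d_def using bt bc cN max_edges_le3[of b c] by simp
      have V2X3: "card (edges_within R V2) = card (edges_within R X3)"
      proof -
        have "V2 = X3" using X3(1) True by (auto simp: V3_def)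
        then show ?thesis by simp
      qed
      have q6: "6 \<le> q" using t ac bc bt by linarith
      have b2: "2 \<le> b" using bt by simp
      have "Suc (q - 3) = q - 2" "Suc (q - 2) = q - 1" using q6 by auto
      then have last2: "max_edges (q - 1) = max_edges (q - 3) + max_min_degree (q - 2) + max_min_degree (q - 1)"
        using max_edges_Suc[of "q - 3"] max_edges_Suc[of "q - 2"] by simp
      show ?thesis
      proof (cases "k = 3 \<and> q = 6")
        case False
        have "card R \<le> max_edges a + (c - 3 + t) * d + (2 + 2 * max_min_degree 3)"
          unfolding add_mult_distrib using total e1 e2 e3 V2X3 e2' e3' by linarith
        also have "max_edges a + (c - 3 + t) * d \<le> max_edges (a + (c - 3 + t))"
          unfolding d_def using ac t q c1 by (intro max_edges_add_ge) auto
        also have "a + (c - 3 + t) = q - 3" using t bt bc by linarith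
        finally have "card R \<le> max_edges (q - 3) + (2 + 2 * max_min_degree 3)"
          by simp
        then show ?thesis
          using max_min_degree_pair[OF q6 q(3) wide[OF b2] False] last2 by simp
      next
        \<comment> \<open>Three components of three vertices each. As \<open>max_edges 5\<close> is
          at least 3 + 2 + 3, only three triangles can exceed it.\<close>
        case kq: True
        then have abc: "a = 3" "b = 3" "c = 3" using t ac bc bt by linarith+
        have "s 0 + 3 \<le> N" using wide[OF b2] by simp
        note D = max_min_degree_3_classes[OF _ this]
        have D3: "max_edges 3 = 3" using D(1) kq max_edges_3 by simp
        have M5: "8 \<le> max_edges (q - 1)"
          using last2 D kq D3 by simp
        have e: "card (edges_within R X1) \<le> 3" "card (edges_within R X2) \<le> 3" "card (edges_within R X3) \<le> 3"
          using e1 e2 e3 abc D3 by auto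
        show ?thesis
        proof (cases "class_size X1 2 = 0 \<or> class_size X2 2 = 0 \<or> class_size X3 2 = 0")
          case True
          then have "card (edges_within R X1) \<le> 2 \<or> card (edges_within R X2) \<le> 2 \<or> card (edges_within R X3) \<le> 2"
            using edges_within_three_missing_class[OF R(1)] X1(1) X2V X3V abc kq
            by (metis a_def b_def c_def)
          then show ?thesis using total V2X3 e M5 by linarith
        next
          \<comment> \<open>All three components meet the smallest class, which therefore has three
            vertices; \<open>N = 9\<close> then forces \<open>K_{3,3,3}\<close>.\<close>
          case False
          then obtain x y z where xyz: "x \<in> X1" "y \<in> X2" "z \<in> X3" "fst x = 2" "fst y = 2" "fst z = 2"
            unfolding class_size_def by (metis (mono_tags, lifting) card.empty empty_Collect_eq)
          then have "x \<noteq> y" "x \<noteq> z" "y \<noteq> z"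
            using X2(1) X3(1) unfolding V1_def V2_def by blast+
          then have "card {x, y, z} = 3" by simp
          moreover have "{x, y, z} \<subseteq> {v \<in> V. fst v = 2}" using xyz X1 X2V X3V by auto
          then have "card {x, y, z} \<le> class_size V 2"
            unfolding class_size_def using finite_V by (intro card_mono) auto
          ultimately have "3 \<le> s 2" using class_size_V[of 2] kq by simp
          moreover have "N = s 0 + s 1 + s 2"
            using kq unfolding N_def by (simp add: numeral_3_eq_3 numeral_2_eq_2)
          moreover have "s 2 \<le> s 1" "s 1 \<le> s 0"
            using antitone[of 1 2] antitone[of 0 1] kq by auto
          ultimately have "exceptional q"
            unfolding exceptional_def using kq three by linarith
          moreover have "card R \<le> Suc (max_edges (q - 1))" using total V2X3 e M5 by linarith
          ultimately show ?thesis by simp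
        qed
      qed
    next
      case ne3: False
      obtain X4 where X4: "X4 \<subseteq> V3" "linked R X4" "closed_in R X4" "closed_in R (V3 - X4)"
        using largest_linked[OF R(1) V3(1) ne3 V3(2)] by metis
      have X4V: "X4 \<subseteq> V" using X4 V3 by auto
      have X4_2: "X4 \<subseteq> V2" "V3 \<subseteq> V2" using X4 by (auto simp: V3_def)
      have b4: "card X4 \<le> b" "1 \<le> card X4"
        using max3[OF X4_2(1) X4(2)] linked_nonempty[OF X4(2)] fin[OF X4V]
        by (auto simp: b_def Suc_le_eq card_gt_0_iff)
      define V4 where "V4 = V3 - X4"
      have cV4: "card V4 = card V3 - card X4" "card X4 \<le> card V3"
        unfolding V4_def using X4(1) fin[OF V3(1)] fin[OF X4V] by (auto simp: card_Diff_subset card_mono)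
      show ?thesis
      proof (cases "V4 = {}")
        case True
        then have s3: "card V3 = card X4" "b + card X4 = 3 + t" using cV4 cV3 three t by auto
        then have b2: "2 \<le> b" using b4 by linarith
        have "card (edges_within R V2) \<le> 1 + (b - 2) * d + (card X4 - 1) * d"
          using total3 e3 max_edges_le2[OF b2 bc cN(1)] small[OF X4_2(2) ne3 V3(2)] s3
          by (simp add: d_def)
        also have "\<dots> = 1 + (b - 2 + (card X4 - 1)) * d" by (simp add: add_mult_distrib)
        also have "b - 2 + (card X4 - 1) = t" using s3 b2 b4 by linarith
        finally show ?thesis using one_extra b2 three by simp
      next
        case False
        have "card (edges_within R V3) = card (edges_within R X4) + card (edges_within R V4)"
          unfolding V4_def by (rule split[OF X4(3,1)])
        moreover have "card (edges_within R X3) \<le> (b - 1) * d"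
          unfolding b_def using small[OF X3(1) linked_nonempty[OF X3(2)] X3(3)] .
        moreover have "card (edges_within R X4) \<le> (card X4 - 1) * d"
          using small[OF X4_2(1) linked_nonempty[OF X4(2)] X4(3)] .
        moreover have "card (edges_within R V4) \<le> (card V4 - 1) * d"
          using X4 X4_2 False by (intro small) (auto simp: V4_def)
        ultimately have "card (edges_within R V2) \<le> (b - 1) * d + (card X4 - 1) * d + (card V4 - 1) * d"
          using total3 by linarith
        also have "\<dots> = (b - 1 + (card X4 - 1) + (card V4 - 1)) * d" by (simp add: add_mult_distrib)
        also have "b - 1 + (card X4 - 1) + (card V4 - 1) = t"
        proof -
          have "0 < card V4" using False fin[of V4] V3(1) by (auto simp: V4_def card_gt_0_iff)
          then show ?thesis using b4 b1 cV3 cV4 three t by linarith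
        qed
        finally show ?thesis by (rule enough)
      qed
    qed
  qed
qed

end

section \<open>The anti-Ramsey numbers\<close>

context multipartite
begin

lemma coloring_bound:
  assumes "2 \<le> q" "N \<le> q + 3" "q < N"
    and c: "edge_coloring (Graph V E) t c" "rainbow_free (Graph V E) (trees_with_edges q) c"
  shows "t \<le> Suc (max_edges (q - 1)) \<or> exceptional q \<and> t \<le> Suc (Suc (max_edges (q - 1)))"
proof -
  have t: "card (c ` E) = t" using c(1) by (simp add: edge_coloring_def)
  have "\<exists>R \<subseteq> E. Suc (card R) = card (c ` E) \<and> \<not> linked R V \<and>
    (\<forall>X Y. X \<subseteq> V \<longrightarrow> Y \<subseteq> V \<longrightarrow> X \<inter> Y = {} \<longrightarrow> linked R X \<longrightarrow> linked R Y \<longrightarrow> card X + card Y \<le> q)"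
  proof (rule rainbow_linked_max_split[OF finite_V edge_subset linked_V])
    show "\<exists>v\<in>D. {w, v} \<in> E" if "w \<in> V" "linked E D" "2 \<le> card D" for w D
      using linked_adjacent[OF that] .
    show "card X \<le> q" if "R \<subseteq> E" "inj_on c R" "X \<subseteq> V" "linked R X" for R X
      using rainbow_free_linked[OF c(2) simple_graph_VE, of R X] that by simp
  qed (use assms(1,3) in \<open>simp_all add: card_V\<close>)
  then obtain R where R: "R \<subseteq> E" "Suc (card R) = card (c ` E)" "\<not> linked R V"
    and pair: "\<forall>X Y. X \<subseteq> V \<longrightarrow> Y \<subseteq> V \<longrightarrow> X \<inter> Y = {} \<longrightarrow> linked R X \<longrightarrow> linked R Y \<longrightarrow> card X + card Y \<le> q"
    by (elim exE conjE)
  have "card R \<le> max_edges (q - 1) \<or> exceptional q \<and> card R \<le> Suc (max_edges (q - 1))"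
    by (rule separated_edges_bound[OF R(1,3) _ assms(1-3)]) (use pair in blast)
  then show ?thesis
    using R(2) unfolding t by linarith
qed

lemma greedy_coloring:
  assumes q: "2 \<le> q" "q < N" and U: "U \<in> greedy_sets (N - q + 1) (Graph V E)"
  shows "\<exists>c. edge_coloring (Graph V E) (Suc (max_edges (q - 1))) c \<and>
    rainbow_free (Graph V E) (trees_with_edges q) c"
proof -
  have UV: "U \<subseteq> V" and cU: "card U = N - q + 1"
    and eU: "card (induced_edges (V - U)) = max_edges (q - 1)"
    using greedy_V[OF U] q by (auto simp: Suc_diff_Suc)
  \<comment> \<open>The parts are \<open>V - U\<close>, with \<open>q - 1\<close> vertices, and
    singletons, so two parts have at most \<open>q\<close> vertices.\<close>
  define \<pi> where "\<pi> v = (if v \<in> U then Some v else None)" for v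
  have R0: "induced_edges (V - U) = {e \<in> edges (Graph V E). \<forall>x\<in>e. \<forall>y\<in>e. \<pi> x = \<pi> y}"
  proof (intro set_eqI iffI)
    fix e assume "e \<in> induced_edges (V - U)"
    then show "e \<in> {e \<in> edges (Graph V E). \<forall>x\<in>e. \<forall>y\<in>e. \<pi> x = \<pi> y}"
      by (auto simp: induced_edges_def \<pi>_def)
  next
    fix e assume e: "e \<in> {e \<in> edges (Graph V E). \<forall>x\<in>e. \<forall>y\<in>e. \<pi> x = \<pi> y}"
    then have "e \<in> E" unfolding graph.sel by blast
    then obtain u v where uv: "e = {u, v}" "u \<in> V" "v \<in> V" "fst u \<noteq> fst v" by (rule edgeE)
    moreover have "\<pi> u = \<pi> v" using e uv(1) by blast
    ultimately have "u \<notin> U" "v \<notin> U" by (auto simp: \<pi>_def split: if_splits)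
    then show "e \<in> induced_edges (V - U)"
      using uv \<open>e \<in> E\<close> by (simp add: induced_edges_def)
  qed
  have fin: "finite U" "finite (V - U)" using UV finite_V finite_subset by auto
  have cVU: "card (V - U) = q - 1"
    using UV cU q fin by (simp add: card_Diff_subset card_V)
  have "U \<noteq> {}" using cU by auto
  then obtain u where u: "u \<in> U" by auto
  \<comment> \<open>A vertex of \<open>U\<close> has a neighbour, so the extra colour really
    occurs.\<close>
  have "u \<in> V" using u UV by blast
  then obtain v where "{u, v} \<in> E"
    using linked_adjacent[of u V] linked_V q card_V by (metis less_imp_le order_trans)
  then have ne: "induced_edges (V - U) \<noteq> edges (Graph V E)"
  proof -
    have "{u, v} \<notin> induced_edges (V - U)" using u by (simp add: induced_edges_def)
    then show ?thesis using \<open>{u, v} \<in> E\<close> by auto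
  qed
  have small: "card {v \<in> verts (Graph V E). \<pi> v = \<pi> x \<or> \<pi> v = \<pi> y} \<le> q" for x y
  proof -
    define B where "B z = {v \<in> V. \<pi> v = \<pi> z}" for z
    have B: "B z \<subseteq> V - U \<or> B z \<subseteq> {z}" for z
      by (cases "z \<in> U") (auto simp: B_def \<pi>_def split: if_splits)
    have "B x \<union> B y \<subseteq> insert x (V - U) \<or> B x \<union> B y \<subseteq> insert y (V - U) \<or> B x \<union> B y \<subseteq> {x, y}"
      using B[of x] B[of y] by blast
    moreover have "card (insert z (V - U)) \<le> q" for z
      using card_insert_le_m1[of q "V - U" z] cVU q by simp
    moreover have "card {x, y} \<le> 2"
      by (simp add: card_insert_if)
    ultimately have "card (B x \<union> B y) \<le> q"
      using q(1) fin by (meson card_mono finite.intros finite_insert order_trans)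
    moreover have "{v \<in> verts (Graph V E). \<pi> v = \<pi> x \<or> \<pi> v = \<pi> y} = B x \<union> B y"
      by (auto simp: B_def)
    ultimately show ?thesis by simp
  qed
  show ?thesis
    using fibre_coloring[OF simple_graph_VE R0 ne small] unfolding eU .
qed

lemma ar_regular:
  assumes "2 \<le> q" "N \<le> q + 3" "q < N" "\<not> exceptional q" "U \<in> greedy_sets (N - q + 1) (Graph V E)"
  shows "ar (Graph V E) (trees_with_edges q) = Suc (max_edges (q - 1))"
proof (rule ar_eqI[OF simple_graph_VE greedy_coloring[OF assms(1,3,5)]])
  show "t \<le> Suc (max_edges (q - 1))"
    if "edge_coloring (Graph V E) t c" "rainbow_free (Graph V E) (trees_with_edges q) c" for t c
    using coloring_bound[OF assms(1-3) that] assms(4) by simp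
qed

text \<open>The fibres of \<open>snd\<close> are cliques with at most \<open>k\<close> vertices, and
  \<open>q = 2 * k\<close>. The edges inside them form a matching of size 3 or three disjoint
  triangles; with the extra colour this gives 4 or 10 colours.\<close>

lemma ar_exceptional:
  assumes ex: "exceptional q"
  shows "ar (Graph V E) (trees_with_edges q) = (if k = 2 then 4 else 10)"
proof -
  define t where "t = (if k = 2 then 4 else 10 :: nat)"
  have s: "s i = 3" if "1 \<le> i" "i < k" for i
  proof -
    have "i = 1 \<or> i = 2" using that ex by (auto simp: exceptional_def)
    then show ?thesis using that ex by (auto simp: exceptional_def)
  qed
  have s0: "3 \<le> s 0" using ex by (auto simp: exceptional_def)
  have q: "q = 2 * k" "k = 2 \<or> k = 3" using ex by (auto simp: exceptional_def)
  have N: "q < N" "N \<le> q + 3"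
  proof -
    have "N = s 0 + (\<Sum>i = 1..<k. s i)"
      unfolding N_def using two_classes by (simp add: sum.atLeast_Suc_lessThan lessThan_atLeast0)
    also have "(\<Sum>i = 1..<k. s i) = 3 * (k - 1)"
      using s by simp
    finally show "q < N" "N \<le> q + 3"
      using ex by (auto simp: exceptional_def)
  qed
  have M: "Suc (Suc (max_edges (q - 1))) \<le> t"
  proof (cases "k = 2")
    case True
    then have "max_min_degree 3 \<le> 1"
      using max_min_degree_le[of 3 1] capped_sum_1 N q by simp
    then show ?thesis using True q max_edges_3 by (simp add: t_def)
  next
    case False
    then have k3: "k = 3" using q by simp
    have D: "max_min_degree 3 \<le> 2" "max_min_degree 4 \<le> 2" "max_min_degree 5 \<le> 3"
      using max_min_degree_le[of 3 0] max_min_degree_le[of 4 1] max_min_degree_le[of 5 1]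
        capped_sum_0 capped_sum_1 N q k3 by auto
    have "max_edges 5 = max_edges 3 + max_min_degree 4 + max_min_degree 5"
      using max_edges_Suc[of 3] max_edges_Suc[of 4] by simp
    then show ?thesis using D k3 q max_edges_3 by (simp add: t_def)
  qed
  \<comment> \<open>An edge inside a fibre is coded by its two classes and the common second
    coordinate, which is below 3 because every class except class 0 has exactly three
    vertices.\<close>
  let ?P = "{(i, j). i < j \<and> j < k} \<times> {..<3::nat}"
  let ?f = "\<lambda>((i, j), a). {(i, a), (j, a)}"
  define R where "R = {e \<in> edges (Graph V E). \<forall>x\<in>e. \<forall>y\<in>e. snd x = snd y}"
  have "R = ?f ` ?P"
  proof (intro set_eqI iffI)
    fix e assume "e \<in> R"
    then have e: "e \<in> E" "\<forall>x\<in>e. \<forall>y\<in>e. snd x = snd y" unfolding R_def graph.sel by blast+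
    from e(1) obtain u v where uv: "e = {u, v}" "u \<in> V" "v \<in> V" "fst u \<noteq> fst v" by (rule edgeE)
    have "snd u = snd v" using e(2) uv(1) by blast
    then obtain i j a where u: "u = (i, a)" and v: "v = (j, a)" by (metis prod.collapse)
    have "\<exists>i j a. i < j \<and> e = {(i, a), (j, a)} \<and> (i, a) \<in> V \<and> (j, a) \<in> V"
    proof (cases "i < j")
      case True
      then show ?thesis using uv u v by blast
    next
      case False
      then have "j < i" using uv u v by simp
      moreover have "e = {(j, a), (i, a)}" using uv(1) u v by (simp add: insert_commute)
      ultimately show ?thesis using uv(2,3) unfolding u v by blast
    qed
    then obtain i j a where ija: "i < j" "e = {(i, a), (j, a)}" "(i, a) \<in> V" "(j, a) \<in> V"
      by blast
    then have "j < k" "a < 3" using s[of j] by (auto simp: V_iff)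
    then show "e \<in> ?f ` ?P" using ija(1,2) by (intro image_eqI[of _ _ "((i, j), a)"]) simp_all
  next
    fix e assume "e \<in> ?f ` ?P"
    then obtain i j a where ija: "i < j" "j < k" "a < 3" "e = {(i, a), (j, a)}" by auto
    moreover have "3 \<le> s i" using s[of i] s0 ija by (cases "i = 0") auto
    ultimately show "e \<in> R" using s[of j] by (auto simp: R_def edge_iff V_iff)
  qed
  moreover have "inj_on ?f ?P"
    by (auto simp: inj_on_def doubleton_eq_iff)
  ultimately have "card R = card {(i, j). i < j \<and> j < k} * 3"
    by (simp add: card_image card_cartesian_product)
  also have "{(i, j). i < j \<and> j < k} = (if k = 2 then {(0, 1)} else {(0, 1), (0, 2), (1, 2)})"
    using q(2) by auto
  finally have cR: "Suc (card R) = t" by (simp add: t_def)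
  have "{(0, 0), (1, 1)} \<in> E"
    using s[of 1] s0 two_classes by (simp add: edge_iff V_iff)
  moreover have "{(0, 0), (1, 1)} \<notin> R" by (simp add: R_def)
  ultimately have ne: "R \<noteq> edges (Graph V E)" by auto
  have small: "card {v \<in> verts (Graph V E). snd v = snd x \<or> snd v = snd y} \<le> q" for x y :: "nat \<times> nat"
  proof -
    have "card {v \<in> verts (Graph V E). snd v = snd x \<or> snd v = snd y} \<le> card ({..<k} \<times> {snd x, snd y})"
      by (intro card_mono) (auto simp: V_iff)
    also have "\<dots> \<le> q" by (simp add: card_insert_if q)
    finally show ?thesis .
  qed
  have "ar (Graph V E) (trees_with_edges q) = t"
  proof (rule ar_eqI[OF simple_graph_VE])
    show "\<exists>c. edge_coloring (Graph V E) t c \<and> rainbow_free (Graph V E) (trees_with_edges q) c"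
      using fibre_coloring[OF simple_graph_VE R_def ne small] unfolding cR .
    show "t' \<le> t"
      if "edge_coloring (Graph V E) t' c" "rainbow_free (Graph V E) (trees_with_edges q) c" for t' c
      using coloring_bound[OF _ N(2,1) that] M q by linarith
  qed
  then show ?thesis by (simp add: t_def)
qed

section \<open>Levels just below \<open>N\<close>\<close>

text \<open>The vertices above height \<open>l\<close> in the four largest classes. These classes
  alone determine \<open>level (N - i)\<close> for \<open>i \<le> 3\<close>, hence the four part
  sizes in the formulas.\<close>

definition excess4 :: "nat \<Rightarrow> nat" where
  "excess4 l = (s 0 - l) + (s 1 - l) + (s 2 - l) + (s 3 - l)"

lemma capped_sum_excess: "capped_sum l + (\<Sum>i<k. s i - l) = N"
  unfolding capped_sum_def N_def sum.distrib[symmetric] by (intro sum.cong) auto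

lemma excess_split:
  assumes "\<And>i. k \<le> i \<Longrightarrow> s i = 0"
  shows "(\<Sum>i<k. s i - l) = excess4 l + (\<Sum>i=4..<k. s i - l)"
proof -
  have "(\<Sum>i<k. s i - l) = (\<Sum>i<k + 4. s i - l)"
    using assms by (intro sum.mono_neutral_left) auto
  also have "{..<k + 4} = {0, 1, 2, 3} \<union> {4..<k + 4}" by auto
  also have "(\<Sum>i\<in>\<dots>. s i - l) = excess4 l + (\<Sum>i=4..<k + 4. s i - l)"
    by (subst sum.union_disjoint) (auto simp: excess4_def)
  also have "(\<Sum>i=4..<k + 4. s i - l) = (\<Sum>i=4..<k. s i - l)"
    using assms by (intro sum.mono_neutral_right) auto
  finally show ?thesis .
qed

text \<open>\<open>N - i\<close> vertices fit under the cap \<open>x\<close> exactly if the total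
  excess over \<open>x\<close> is at most \<open>i\<close>. At \<open>x\<close> the classes after
  the fourth have no excess by \<open>s 3 \<le> x\<close>; at \<open>x - 1\<close> the first four
  already exceed \<open>i\<close>. As there may be fewer than four classes, \<open>s\<close> has to
  vanish from \<open>k\<close> on.\<close>

lemma level_eqI:
  assumes zero: "\<And>i. k \<le> i \<Longrightarrow> s i = 0" and i: "i < N"
    and x: "s 3 \<le> x" "excess4 x \<le> i" "x \<noteq> 0 \<Longrightarrow> i < excess4 (x - 1)"
  shows "level (N - i) = x"
proof -
  have "(\<Sum>j=4..<k. s j - x) = 0"
    using antitone x(1) by (auto intro: order_trans[of _ "s 3"])
  then have "N - i \<le> capped_sum x"
    using capped_sum_excess[of x] excess_split[OF zero, of x] x(2) by linarith
  then have le: "level (N - i) \<le> x" by (rule level_le)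
  show ?thesis
  proof (cases "x = 0")
    case False
    then have "capped_sum (x - 1) < N - i"
      using capped_sum_excess[of "x - 1"] excess_split[OF zero, of "x - 1"] x(3) i by linarith
    then have "\<not> level (N - i) \<le> x - 1"
      using level_le_iff[of "N - i" "x - 1"] by simp
    then show ?thesis using le by linarith
  qed (use le in simp)
qed

lemma int_max_min_degree:
  "i \<le> N \<Longrightarrow> int (max_min_degree (N - i)) = int N - int i - int (level (N - i))"
  using level_le_self[of "N - i"] by (simp add: max_min_degree_def)

lemma complete_multipartite_eq:
  assumes "length ps = k" "\<And>i. i < k \<Longrightarrow> ps ! i = s i"
  shows "complete_multipartite ps = Graph V E"
proof -
  have "{(i, a). i < length ps \<and> a < ps ! i} = V"
    unfolding V_def assms(1) using assms(2) by auto
  then show ?thesis unfolding complete_multipartite_def E_def by (simp only: Let_def)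
qed

end

section \<open>The exceptional graphs and the explicit formulas\<close>

lemma ar_special:
  "ar (complete_multipartite [3, 3]) (trees_with_edges 4) = 4"
  "ar (complete_multipartite [4, 3]) (trees_with_edges 4) = 4"
  "ar (complete_multipartite [3, 3, 3]) (trees_with_edges 6) = 10"
proof -
  interpret A: multipartite "\<lambda>_. 3" 2 by unfold_locales auto
  have "complete_multipartite [3, 3] = Graph A.V A.E"
    by (rule A.complete_multipartite_eq) (auto simp: less_Suc_eq numeral_2_eq_2)
  then show "ar (complete_multipartite [3, 3]) (trees_with_edges 4) = 4"
    using A.ar_exceptional[of 4] by (simp add: A.exceptional_def)
  interpret B: multipartite "\<lambda>i. if i = 0 then 4 else 3" 2 by unfold_locales auto
  have "complete_multipartite [4, 3] = Graph B.V B.E"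
    by (rule B.complete_multipartite_eq) (auto simp: less_Suc_eq numeral_2_eq_2)
  then show "ar (complete_multipartite [4, 3]) (trees_with_edges 4) = 4"
    using B.ar_exceptional[of 4] by (simp add: B.exceptional_def)
  interpret C: multipartite "\<lambda>_. 3" 3 by unfold_locales auto
  have "complete_multipartite [3, 3, 3] = Graph C.V C.E"
    by (rule C.complete_multipartite_eq) (auto simp: less_Suc_eq numeral_3_eq_3)
  then show "ar (complete_multipartite [3, 3, 3]) (trees_with_edges 6) = 10"
    using C.ar_exceptional[of 6] by (simp add: C.exceptional_def)
qed

theorem theorem6p1:
  fixes p :: "nat \<Rightarrow> nat" and k n q :: nat and G :: "(nat \<times> nat) graph"
  assumes "2 \<le> k"
    and "\<forall>i j. 1 \<le> i \<and> i \<le> j \<and> j \<le> k \<longrightarrow> p j \<le> p i"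
    and "1 \<le> p k"
    and "\<forall>i>k. p i = 0"
    and "G = complete_multipartite (map p [1..<k + 1])"
    and "n = (\<Sum>i=1..k. p i)"
    and "max 2 (int n - 3) \<le> int q" and "int q \<le> int n - 1"
  shows
    "((G, q) \<in> {(complete_multipartite [3, 3], 4), (complete_multipartite [4, 3], 4)} \<longrightarrow>
        ar G (trees_with_edges q) = 4) \<and>
     ((G, q) = (complete_multipartite [3, 3, 3], 6) \<longrightarrow>
        ar G (trees_with_edges q) = 10) \<and>
     ((G, q) \<notin> {(complete_multipartite [3, 3], 4), (complete_multipartite [4, 3], 4),
                (complete_multipartite [3, 3, 3], 6)} \<longrightarrow>
      (\<forall>S\<^sub>0 \<in> greedy_sets (n - q + 1) G.
        int (ar G (trees_with_edges q)) =
          1 + (\<Sum>j=1..k. \<Sum>i=1..<j. int (p i) * int (p j)) - int (card (incident_edges G S\<^sub>0)) \<and>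
        (int q = int n - 1 \<longrightarrow>
          (p 1 > p 2 \<longrightarrow>
             int (card (incident_edges G S\<^sub>0)) = 2 * int n - 2 * int (p 1)) \<and>
          (p 1 = p 2 \<longrightarrow>
             int (card (incident_edges G S\<^sub>0)) = 2 * int n - int (p 1) - int (p 2) - 1)) \<and>
        (int q = int n - 2 \<longrightarrow>
          (p 1 \<ge> p 2 + 2 \<longrightarrow>
             int (card (incident_edges G S\<^sub>0)) = 3 * int n - 3 * int (p 1)) \<and>
          (p 2 + 1 \<ge> p 1 \<and> p 1 \<ge> p 3 + 1 \<longrightarrow>
             int (card (incident_edges G S\<^sub>0)) = 3 * int n - 2 * int (p 1) - int (p 2) - 2) \<and>
          (p 1 = p 2 \<and> p 2 = p 3 \<longrightarrow>
             int (card (incident_edges G S\<^sub>0)) =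
               3 * int n - int (p 1) - int (p 2) - int (p 3) - 3)) \<and>
        (int q = int n - 3 \<longrightarrow>
          (p 1 \<ge> p 2 + 3 \<longrightarrow>
             int (card (incident_edges G S\<^sub>0)) = 4 * int n - 4 * int (p 1)) \<and>
          (p 1 = p 2 + 2 \<or> (p 1 = p 2 + 1 \<and> p 2 + 1 \<ge> p 3 + 2) \<longrightarrow>
             int (card (incident_edges G S\<^sub>0)) = 4 * int n - 3 * int (p 1) - int (p 2) - 3) \<and>
          (p 1 = p 2 \<and> p 2 \<ge> p 3 + 1 \<longrightarrow>
             int (card (incident_edges G S\<^sub>0)) = 4 * int n - 2 * int (p 1) - 2 * int (p 2) - 4) \<and>
          (p 4 + 1 \<le> p 1 \<and> p 1 \<le> p 2 + 1 \<and> p 2 + 1 = p 3 + 1 \<longrightarrow>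
             int (card (incident_edges G S\<^sub>0)) =
               4 * int n - 2 * int (p 1) - int (p 2) - int (p 3) - 5) \<and>
          (p 1 = p 2 \<and> p 2 = p 3 \<and> p 3 = p 4 \<longrightarrow>
             int (card (incident_edges G S\<^sub>0)) = 4 * int n - (\<Sum>i=1..4. int (p i)) - 6))))"
proof -
  define s where "s i = p (Suc i)" for i
  interpret multipartite s k
  proof
    show "s j \<le> s i" if "i \<le> j" "j < k" for i j
      unfolding s_def using assms(2)[rule_format, of "Suc i" "Suc j"] that by simp
    show "1 \<le> s i" if "i < k" for i
      unfolding s_def using assms(2)[rule_format, of "Suc i" k] assms(3) that by simp
  qed (fact assms(1))
  have G: "G = Graph V E"
    unfolding assms(5) by (rule complete_multipartite_eq) (simp_all add: s_def del: upt_Suc)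
  have n: "n = N"
    unfolding assms(6) N_def s_def One_nat_def by (rule sum.atLeast1_atMost_eq)
  have q: "2 \<le> q" "N \<le> q + 3" "q < N"
    using assms(7,8) n by linarith+
  have zero: "s i = 0" if "k \<le> i" for i
    using assms(4) that by (simp add: s_def)
  have p: "p 1 = s 0" "p 2 = s 1" "p 3 = s 2" "p 4 = s 3" "(\<Sum>i=1..4. int (p i)) = int (s 0) + int (s 1) + int (s 2) + int (s 3)"
    by (simp_all add: s_def eval_nat_numeral)
  have ord: "s (Suc i) \<le> s i" for i
    using antitone[of i "Suc i"] zero[of "Suc i"] by (cases "Suc i < k") auto
  have ord: "s 1 \<le> s 0" "s 2 \<le> s 1" "s 3 \<le> s 2" "1 \<le> s 0" "1 \<le> s 1"
    using ord[of 0] ord[of 1] ord[of 2] pos[of 0] pos[of 1] assms(1)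
    by (auto simp: eval_nat_numeral)
  have E_sum: "(\<Sum>j=1..k. \<Sum>i=1..<j. int (p i) * int (p j)) = int (card E)"
  proof -
    have "(\<Sum>j=1..k. \<Sum>i=1..<j. int (p i) * int (p j)) =
        (\<Sum>j<k. \<Sum>i=1..<Suc j. int (p i) * int (p (Suc j)))"
      unfolding One_nat_def by (rule sum.atLeast1_atMost_eq)
    also have "\<dots> = (\<Sum>j<k. \<Sum>i<j. int (s i) * int (s j))"
      unfolding s_def One_nat_def atLeastLessThanSuc_atLeastAtMost sum.atLeast1_atMost_eq ..
    finally show ?thesis by (simp add: card_E_sum)
  qed
  have main: "int (ar G (trees_with_edges q)) =
          1 + (\<Sum>j=1..k. \<Sum>i=1..<j. int (p i) * int (p j)) - int (card (incident_edges G S\<^sub>0))"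
    if "\<not> exceptional q" "S\<^sub>0 \<in> greedy_sets (n - q + 1) G" for S\<^sub>0
  proof -
    have S: "S\<^sub>0 \<in> greedy_sets (N - q + 1) (Graph V E)" using that(2) G n by simp
    have "ar G (trees_with_edges q) = Suc (max_edges (q - 1))"
      unfolding G by (rule ar_regular[OF q that(1) S])
    moreover have "N - (N - q + 1) = q - 1" using q by simp
    ultimately show ?thesis
      using card_incident[OF greedy_V(1)[OF S]] greedy_V(3)[OF S] E_sum G by simp
  qed
  have inc: "card (incident_edges G S\<^sub>0) + max_edges (q - 1) = max_edges N"
    if "S\<^sub>0 \<in> greedy_sets (n - q + 1) G" for S\<^sub>0
  proof -
    have S: "S\<^sub>0 \<in> greedy_sets (N - q + 1) (Graph V E)" using that G n by simp
    have "N - (N - q + 1) = q - 1" using q by simp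
    then show ?thesis
      using card_incident[OF greedy_V(1)[OF S]] greedy_V(3)[OF S] card_E G by simp
  qed
  have Mq: "max_edges q = max_edges (q - 1) + max_min_degree q"
    using max_edges_Suc[of "q - 1"] q by simp
  have M1: "max_edges (q + 1) = max_edges (q - 1) + max_min_degree q + max_min_degree (q + 1)"
    using max_edges_Suc[of q] Mq by simp
  have M2: "max_edges (q + 2) = max_edges (q + 1) + max_min_degree (q + 2)"
    using max_edges_Suc[of "q + 1"] by simp
  have M3: "max_edges (q + 3) = max_edges (q + 2) + max_min_degree (q + 3)"
    using max_edges_Suc[of "q + 2"] by (simp add: eval_nat_numeral)
  have L0: "level N = s 0"
    using level_eqI[OF zero, of 0 "s 0"] q ord by (simp add: excess4_def)
  have L1a: "level (N - 1) = s 0 - 1" if "s 1 < s 0"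
    using that q ord by (intro level_eqI[OF zero]) (auto simp: excess4_def)
  have L1b: "level (N - 1) = s 0" if "s 0 = s 1"
    using that q ord by (intro level_eqI[OF zero]) (auto simp: excess4_def)
  have L2a: "level (N - 2) = s 0 - 2" if "s 1 + 2 \<le> s 0"
    using that q ord by (intro level_eqI[OF zero]) (auto simp: excess4_def)
  have L2b: "level (N - 2) = s 0 - 1" if "s 0 \<le> s 1 + 1" "s 2 + 1 \<le> s 0"
    using that q ord by (intro level_eqI[OF zero]) (auto simp: excess4_def)
  have L2c: "level (N - 2) = s 0" if "s 0 = s 1" "s 1 = s 2"
    using that q ord by (intro level_eqI[OF zero]) (auto simp: excess4_def)
  \<comment> \<open>The premise \<open>N = q + 3\<close> together with \<open>2 \<le> q\<close>
    gives \<open>3 < N\<close>, as \<open>level_eqI\<close> requires.\<close>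
  have L3a: "level (N - 3) = s 0 - 3" if "s 1 + 3 \<le> s 0" "N = q + 3"
    using that q ord by (intro level_eqI[OF zero]) (auto simp: excess4_def)
  have L3b: "level (N - 3) = s 0 - 2" if "s 0 = s 1 + 2 \<or> s 0 = s 1 + 1 \<and> s 2 + 2 \<le> s 1 + 1" "N = q + 3"
    using that q ord by (intro level_eqI[OF zero]) (auto simp: excess4_def)
  have L3c: "level (N - 3) = s 0 - 1" if "s 0 = s 1" "s 2 + 1 \<le> s 1" "N = q + 3"
    using that q ord by (intro level_eqI[OF zero]) (auto simp: excess4_def)
  have L3d: "level (N - 3) = s 0 - 1" if "s 3 + 1 \<le> s 0" "s 0 \<le> s 1 + 1" "s 1 = s 2" "N = q + 3"
    using that q ord by (intro level_eqI[OF zero]) (auto simp: excess4_def)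
  have L3e: "level (N - 3) = s 0" if "s 0 = s 1" "s 1 = s 2" "s 2 = s 3" "N = q + 3"
    using that q ord by (intro level_eqI[OF zero]) (auto simp: excess4_def)
  have L1: "level (N - 1) = (if s 1 < s 0 then s 0 - 1 else s 0)"
    using L1a L1b ord by auto
  have L2: "level (N - 2) = (if s 1 + 2 \<le> s 0 then s 0 - 2 else if s 2 + 1 \<le> s 0 then s 0 - 1 else s 0)"
    using L2a L2b L2c ord by auto
  have D0: "int (max_min_degree N) = int N - int (s 0)"
    using int_max_min_degree[of 0] L0 by simp
  have D1: "int (max_min_degree (N - 1)) = int N - 1 - int (level (N - 1))"
    using int_max_min_degree[of 1] q by simp
  have D2: "int (max_min_degree (N - 2)) = int N - 2 - int (level (N - 2))" if "N = q + 2 \<or> N = q + 3"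
    using int_max_min_degree[of 2] that by linarith
  have D3: "int (max_min_degree (N - 3)) = int N - 3 - int (level (N - 3))" if "N = q + 3"
    using int_max_min_degree[of 3] that by linarith
  \<comment> \<open>By \<open>inc\<close> the edges met by the greedy set number the last
    \<open>N - q + 1\<close> increments of \<open>max_edges\<close>. Each increment is
    \<open>N - i\<close> minus a level, so the constants 1, 3 and 6 are the sums of \<open>i\<close>
    up to 1, 2 and 3.\<close>
  have I1: "int (card (incident_edges G S\<^sub>0)) = 2 * int N - 1 - int (s 0) - int (level (N - 1))"
    if "S\<^sub>0 \<in> greedy_sets (n - q + 1) G" "N = q + 1" for S\<^sub>0
    using inc[OF that(1)] M1 D0 D1 that(2) by simp
  have I2: "int (card (incident_edges G S\<^sub>0)) =
      3 * int N - 3 - int (s 0) - int (level (N - 1)) - int (level (N - 2))"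
    if "S\<^sub>0 \<in> greedy_sets (n - q + 1) G" "N = q + 2" for S\<^sub>0
    using inc[OF that(1)] M1 M2 D0 D1 D2 that(2) by simp
  have I3: "int (card (incident_edges G S\<^sub>0)) =
      4 * int N - 6 - int (s 0) - int (level (N - 1)) - int (level (N - 2)) - int (level (N - 3))"
    if "S\<^sub>0 \<in> greedy_sets (n - q + 1) G" "N = q + 3" for S\<^sub>0
    using inc[OF that(1)] M1 M2 M3 D0 D1 D2 D3 that(2) by (simp add: eval_nat_numeral)
  have not_exceptional: "\<not> exceptional q"
    if "(G, q) \<notin> {(complete_multipartite [3, 3], 4), (complete_multipartite [4, 3], 4),
                (complete_multipartite [3, 3, 3], 6)}"
    using that unfolding assms(5) exceptional_def
    by (auto simp: s_def eval_nat_numeral)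
  show ?thesis
  proof (intro conjI impI ballI)
    assume "(G, q) \<in> {(complete_multipartite [3, 3], 4), (complete_multipartite [4, 3], 4)}"
    then show "ar G (trees_with_edges q) = 4" using ar_special by auto
  next
    assume "(G, q) = (complete_multipartite [3, 3, 3], 6)"
    then show "ar G (trees_with_edges q) = 10" using ar_special by auto
  next
    fix S\<^sub>0
    assume "(G, q) \<notin> {(complete_multipartite [3, 3], 4), (complete_multipartite [4, 3], 4),
                (complete_multipartite [3, 3, 3], 6)}" "S\<^sub>0 \<in> greedy_sets (n - q + 1) G"
    then show "int (ar G (trees_with_edges q)) =
          1 + (\<Sum>j=1..k. \<Sum>i=1..<j. int (p i) * int (p j)) - int (card (incident_edges G S\<^sub>0))"
      by (intro main not_exceptional)
  next
    fix S\<^sub>0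
    assume S: "S\<^sub>0 \<in> greedy_sets (n - q + 1) G" and r: "int q = int n - 1" and gap: "p 1 > p 2"
    have "N = q + 1" using r n by simp
    then show "int (card (incident_edges G S\<^sub>0)) = 2 * int n - 2 * int (p 1)"
      using I1[OF S] gap n ord L1 L2 unfolding p by (auto split: if_splits)
  next
    fix S\<^sub>0
    assume S: "S\<^sub>0 \<in> greedy_sets (n - q + 1) G" and r: "int q = int n - 1" and gap: "p 1 = p 2"
    have "N = q + 1" using r n by simp
    then show "int (card (incident_edges G S\<^sub>0)) = 2 * int n - int (p 1) - int (p 2) - 1"
      using I1[OF S] gap n ord L1 L2 unfolding p by (auto split: if_splits)
  next
    fix S\<^sub>0
    assume S: "S\<^sub>0 \<in> greedy_sets (n - q + 1) G" and r: "int q = int n - 2" and gap: "p 1 \<ge> p 2 + 2"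
    have "N = q + 2" using r n by simp
    then show "int (card (incident_edges G S\<^sub>0)) = 3 * int n - 3 * int (p 1)"
      using I2[OF S] gap n ord L1 L2 unfolding p by (auto split: if_splits)
  next
    fix S\<^sub>0
    assume S: "S\<^sub>0 \<in> greedy_sets (n - q + 1) G" and r: "int q = int n - 2" and gap: "p 2 + 1 \<ge> p 1 \<and> p 1 \<ge> p 3 + 1"
    have "N = q + 2" using r n by simp
    then show "int (card (incident_edges G S\<^sub>0)) = 3 * int n - 2 * int (p 1) - int (p 2) - 2"
      using I2[OF S] gap n ord L1 L2 unfolding p by (auto split: if_splits)
  next
    fix S\<^sub>0
    assume S: "S\<^sub>0 \<in> greedy_sets (n - q + 1) G" and r: "int q = int n - 2" and gap: "p 1 = p 2 \<and> p 2 = p 3"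
    have "N = q + 2" using r n by simp
    then show "int (card (incident_edges G S\<^sub>0)) = 3 * int n - int (p 1) - int (p 2) - int (p 3) - 3"
      using I2[OF S] gap n ord L1 L2 unfolding p by (auto split: if_splits)
  next
    fix S\<^sub>0
    assume S: "S\<^sub>0 \<in> greedy_sets (n - q + 1) G" and r: "int q = int n - 3" and gap: "p 1 \<ge> p 2 + 3"
    have "N = q + 3" using r n by simp
    then show "int (card (incident_edges G S\<^sub>0)) = 4 * int n - 4 * int (p 1)"
      using I3[OF S] gap n ord L1 L2 L3a L3b L3c L3d L3e unfolding p by (auto split: if_splits)
  next
    fix S\<^sub>0
    assume S: "S\<^sub>0 \<in> greedy_sets (n - q + 1) G" and r: "int q = int n - 3" and gap: "p 1 = p 2 + 2 \<or> (p 1 = p 2 + 1 \<and> p 2 + 1 \<ge> p 3 + 2)"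
    have "N = q + 3" using r n by simp
    then show "int (card (incident_edges G S\<^sub>0)) = 4 * int n - 3 * int (p 1) - int (p 2) - 3"
      using I3[OF S] gap n ord L1 L2 L3a L3b L3c L3d L3e unfolding p by (auto split: if_splits)
  next
    fix S\<^sub>0
    assume S: "S\<^sub>0 \<in> greedy_sets (n - q + 1) G" and r: "int q = int n - 3" and gap: "p 1 = p 2 \<and> p 2 \<ge> p 3 + 1"
    have "N = q + 3" using r n by simp
    then show "int (card (incident_edges G S\<^sub>0)) = 4 * int n - 2 * int (p 1) - 2 * int (p 2) - 4"
      using I3[OF S] gap n ord L1 L2 L3a L3b L3c L3d L3e unfolding p by (auto split: if_splits)
  next
    fix S\<^sub>0
    assume S: "S\<^sub>0 \<in> greedy_sets (n - q + 1) G" and r: "int q = int n - 3" and gap: "p 4 + 1 \<le> p 1 \<and> p 1 \<le> p 2 + 1 \<and> p 2 + 1 = p 3 + 1"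
    have "N = q + 3" using r n by simp
    then show "int (card (incident_edges G S\<^sub>0)) = 4 * int n - 2 * int (p 1) - int (p 2) - int (p 3) - 5"
      using I3[OF S] gap n ord L1 L2 L3a L3b L3c L3d L3e unfolding p by (auto split: if_splits)
  next
    fix S\<^sub>0
    assume S: "S\<^sub>0 \<in> greedy_sets (n - q + 1) G" and r: "int q = int n - 3" and gap: "p 1 = p 2 \<and> p 2 = p 3 \<and> p 3 = p 4"
    have "N = q + 3" using r n by simp
    then show "int (card (incident_edges G S\<^sub>0)) = 4 * int n - (\<Sum>i=1..4. int (p i)) - 6"
      using I3[OF S] gap n ord L1 L2 L3a L3b L3c L3d L3e unfolding p by (auto split: if_splits)
  qed
qed

end
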